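(* Let $P_0(t),H_0(t)\in\mathbb{R}$, $\mu_1,\Delta P(t),\Delta H(t)\ge0$ and $\delta_{P,t},\delta_{H,t}>0$ for $t=1,\dots,T$, and let $\mathcal{W}\subset\mathbb{R}^{2T}$ be the set of all $(P(t),H(t))_{t=1}^T$ of the form $$P(t)=P_0(t)+\eta^P_1(t)+\eta^P_\infty(t),\qquad H(t)=H_0(t)+\eta^H_1(t)+\eta^H_\infty(t),$$ $$\sum_{t=1}^T\big[|\delta_{P,t}\eta^P_1(t)|+|\delta_{H,t}\eta^H_1(t)|\big]\le\mu_1,\qquad |\eta^P_\infty(t)|\le\Delta P(t),\quad |\eta^H_\infty(t)|\le\Delta H(t)\quad\forall t.$$ Then Algorithm A (described in the context) solves the robust shortest-path problem $$\min_{p\in\mathrm{PATH}_{s\to q}(\mathcal{G})}\ \max_{\xi\in\mathcal{W}}\ \sum_{e\in p}w_e(\xi),$$ with computational complexity $O(|\mathcal{E}|^2)$.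
   Context: Turbine model: $\mathcal{X}$ is a finite set of states; for each $x\in\mathcal{X}$, $\mathcal{U}(x)$ is the set of admissible controls at $x$; applying $u\in\mathcal{U}(x)$ at $x$ leads to the state $f(x,u)\in\mathcal{X}$ after $c(x,u)\in\{1,2,\dots\}$ time steps. $C_{\rm MGT}(x,u)$ is the operating cost of this transition, and $P_{\rm MGT}(x,u),H_{\rm MGT}(x,u)$ are the power and heat generated per time step. $T\in\mathbb{N}$ is the horizon. For each $t\in\{1,\dots,T\}$, $C^P_{U,t},C^H_{U,t}:\mathbb{R}\to\mathbb{R}\cup\{+\infty\}$ are the costs of purchasing power and heat from a utility (negative arguments mean selling power or exhausting heat; an infinite cost models inability to sell power); each is convex and is non-decreasing on the set where it is finite, and $C^H_{U,t}(x)=0$ for $x<0$. A demand profile is $\xi=(P(t),H(t))_{t=1}^T\in\mathbb{R}^{2T}$. Graph: $\mathcal{G}=(\mathcal{V},\mathcal{E})$ is the finite directed acyclic graph whose vertices are the pairs $(t,x)$, $t\in\{1,\dots,T\}$, $x\in\mathcal{X}$, together with a source $s$ and a terminal $q$. There is a transition edge $e=(t_1,x_1)\to(t_2,x_2)$ whenever there is some $u_1\in\mathcal{U}(x_1)$ with $f(x_1,u_1)=x_2$ and $t_2=t_1+c(x_1,u_1)$; its cost is $$w_e(\xi)=C_{\rm MGT}(x_1,u_1)+\sum_{t=t_1}^{t_2-1}\big[C^P_{U,t}(P(t)-P_{\rm MGT}(x_1,u_1))+C^H_{U,t}(H(t)-H_{\rm MGT}(x_1,u_1))\big].$$ For every $x\in\mathcal{X}$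 there are also edges $s\to(1,x)$ and $(T,x)\to q$ of cost zero. $\mathrm{PATH}_{s\to q}(\mathcal{G})$ is the set of directed paths from $s$ to $q$. Let $\bar P_0(t)=P_0(t)+\Delta P(t)$, $\bar H_0(t)=H_0(t)+\Delta H(t)$, and for $i=1,\dots,T$ let $\Delta P^{(i)}(t)=\frac{\mu_1}{\delta_{P,t}}\mathbf{1}_{\{i=t\}}$, $\Delta H^{(i)}(t)=\frac{\mu_1}{\delta_{H,t}}\mathbf{1}_{\{i=t\}}$. For a transition edge $e$ from time $t_1$ to time $t_2$, define $W_{\rm bias}(e)=w_e\big((\bar P_0(t),\bar H_0(t))_{t=1}^T\big)$ and $$W_{\rm spike}(e)=\max_{t_1\le k<t_2}\max\Big\{w_e\big((\bar P_0(t)+\Delta P^{(k)}(t),\bar H_0(t))_{t=1}^T\big),\ w_e\big((\bar P_0(t),\bar H_0(t)+\Delta H^{(k)}(t))_{t=1}^T\big)\Big\}-W_{\rm bias}(e).$$ The zero-cost edges at $s$ and $q$ have $W_{\rm bias}=0$; sets, maxima and minima of values of $W_{\rm spike}$ range over transition edges only. For $\alpha\in\mathbb{R}$, $\mathcal{G}_\alpha$ is the graph $(\mathcal{V},\mathcal{E})$ with weights $\omega_\alpha(e)=W_{\rm bias}(e)$ if $W_{\rm spike}(e)\le\alpha$ and $\omega_\alpha(e)=\infty$ if $W_{\rm spike}(e)>\alpha$ (the edges at $s$ and $q$ keep weight zero). Algorithm A: (1) Compute $W_{\rm bias}(e)$ and $W_{\rm spike}(e)$ for each edge $e$. (2) Set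 ${\rm Thresh}=\{W_{\rm spike}(e)\}_{e\in\mathcal{E}}$. (3) For each $\alpha\in{\rm Thresh}$, solve the shortest-path problem from $s$ to $q$ in $\mathcal{G}_\alpha$, in case of a tie favoring the path with the lower maximal $W_{\rm spike}$; let $V_{\rm path}(\alpha)$ be the optimal path and set $V_{\rm cost}(\alpha)=\sum_{e\in V_{\rm path}(\alpha)}W_{\rm bias}(e)+\max_{e\in V_{\rm path}(\alpha)}W_{\rm spike}(e)$. (4) Find $\gamma\in\arg\min_{\beta\in{\rm Thresh}}V_{\rm cost}(\beta)$ and return $V_{\rm cost}(\gamma)$ and $V_{\rm path}(\gamma)$.
   Formalization: Added hypothesis: an edge with finite W_bias has finite w_e for every demand in W below the bias (the claim fails if power cannot be sold). Existence of an output is claimed only for T≥2 (Thresh is empty at T=1). The O(|E|^2) constant depends on an upper bound for the durations c(x,u). *)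

theory Defs
  imports "HOL-Library.Extended_Real" "HOL-Library.Monad_Syntax" "Graph_Theory.Arc_Walk"
begin

section \<open>Problem data\<close>

record ('x, 'u) dispatch =
  states :: "'x set"
  controls :: "'x \<Rightarrow> 'u set"
  successor :: "'x \<Rightarrow> 'u \<Rightarrow> 'x"
  duration :: "'x \<Rightarrow> 'u \<Rightarrow> nat"
  C_MGT :: "'x \<Rightarrow> 'u \<Rightarrow> real"
  P_MGT :: "'x \<Rightarrow> 'u \<Rightarrow> real"
  H_MGT :: "'x \<Rightarrow> 'u \<Rightarrow> real"
  horizon :: nat
  C_power :: "nat \<Rightarrow> real \<Rightarrow> ereal"
  C_heat :: "nat \<Rightarrow> real \<Rightarrow> ereal"
  P_nom :: "nat \<Rightarrow> real"
  H_nom :: "nat \<Rightarrow> real"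
  mu1 :: real
  Delta_P :: "nat \<Rightarrow> real"
  Delta_H :: "nat \<Rightarrow> real"
  delta_P :: "nat \<Rightarrow> real"
  delta_H :: "nat \<Rightarrow> real"

text \<open>The codomain of a utility cost is the real line with positive infinity added, so the
  value minus infinity is excluded.\<close>

definition utility_cost :: "(real \<Rightarrow> ereal) \<Rightarrow> bool" where
  "utility_cost C \<longleftrightarrow>
     (\<forall>x. C x \<noteq> -\<infinity>) \<and>
     (\<forall>x y l. 0 < l \<and> l < 1 \<longrightarrow>
        C ((1 - l) * x + l * y) \<le> ereal (1 - l) * C x + ereal l * C y) \<and>
     mono_on {x. C x \<noteq> \<infinity>} C"

definition valid_dispatch :: "('x, 'u) dispatch \<Rightarrow> bool" where
  "valid_dispatch I \<longleftrightarrow>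
     finite (states I) \<and>
     (\<forall>x\<in>states I. finite (controls I x)) \<and>
     (\<forall>x\<in>states I. \<forall>u\<in>controls I x. successor I x u \<in> states I \<and> 1 \<le> duration I x u) \<and>
     1 \<le> horizon I \<and>
     0 \<le> mu1 I \<and>
     (\<forall>t\<in>{1..horizon I}.
        utility_cost (C_power I t) \<and> utility_cost (C_heat I t) \<and>
        (\<forall>x<0. C_heat I t x = 0) \<and>
        0 \<le> Delta_P I t \<and> 0 \<le> Delta_H I t \<and> 0 < delta_P I t \<and> 0 < delta_H I t)"

section \<open>The graph\<close>

datatype 'x vertex = Source | Node nat 'x | Terminal

text \<open>A transition arc carries the control that it applies: its cost depends on the control,
  and two controls may lead to the same state after the same time. The graph is therefore a
  multigraph, with one arc for each admissible control.\<close>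

datatype ('x, 'u) arc = Depart 'x | is_Trans: Trans nat 'x 'u | Arrive 'x

primrec arc_tail :: "('x, 'u) dispatch \<Rightarrow> ('x, 'u) arc \<Rightarrow> 'x vertex" where
  "arc_tail I (Depart x) = Source"
| "arc_tail I (Trans t x u) = Node t x"
| "arc_tail I (Arrive x) = Node (horizon I) x"

primrec arc_head :: "('x, 'u) dispatch \<Rightarrow> ('x, 'u) arc \<Rightarrow> 'x vertex" where
  "arc_head I (Depart x) = Node 1 x"
| "arc_head I (Trans t x u) = Node (t + duration I x u) (successor I x u)"
| "arc_head I (Arrive x) = Terminal"

definition dispatch_graph :: "('x, 'u) dispatch \<Rightarrow> ('x vertex, ('x, 'u) arc) pre_digraph" where
  "dispatch_graph I =
     \<lparr>verts = {Node t x |t x. t \<in> {1..horizon I} \<and> x \<in> states I} \<union> {Source, Terminal},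
      arcs = {Depart x |x. x \<in> states I} \<union>
             {Trans t x u |t x u. t \<in> {1..horizon I} \<and> x \<in> states I \<and> u \<in> controls I x \<and>
                                  t + duration I x u \<le> horizon I} \<union>
             {Arrive x |x. x \<in> states I},
      tail = arc_tail I, head = arc_head I\<rparr>"

definition PATH :: "('x, 'u) dispatch \<Rightarrow> ('x, 'u) arc list set" where
  "PATH I = {p. pre_digraph.apath (dispatch_graph I) Source p Terminal}"

section \<open>Demands and costs\<close>

text \<open>A demand profile is a pair of the power demand and the heat demand. Only the values at
  times from 1 to the horizon enter a definition.\<close>

type_synonym demand = "(nat \<Rightarrow> real) \<times> (nat \<Rightarrow> real)"

primrec weight :: "('x, 'u) dispatch \<Rightarrow> demand \<Rightarrow> ('x, 'u) arc \<Rightarrow> ereal" where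
  "weight I \<xi> (Depart x) = 0"
| "weight I \<xi> (Trans t x u) =
     ereal (C_MGT I x u) +
     (\<Sum>\<tau>\<in>{t..<t + duration I x u}.
        C_power I \<tau> (fst \<xi> \<tau> - P_MGT I x u) + C_heat I \<tau> (snd \<xi> \<tau> - H_MGT I x u))"
| "weight I \<xi> (Arrive x) = 0"

definition demand_set :: "('x, 'u) dispatch \<Rightarrow> demand set" where
  "demand_set I = {(P, H). \<exists>\<eta>P1 \<eta>Pinf \<eta>H1 \<eta>Hinf.
     (\<forall>t\<in>{1..horizon I}.
        P t = P_nom I t + \<eta>P1 t + \<eta>Pinf t \<and> H t = H_nom I t + \<eta>H1 t + \<eta>Hinf t \<and>
        \<bar>\<eta>Pinf t\<bar> \<le> Delta_P I t \<and> \<bar>\<eta>Hinf t\<bar> \<le> Delta_H I t) \<and>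
     (\<Sum>t=1..horizon I. \<bar>delta_P I t * \<eta>P1 t\<bar> + \<bar>delta_H I t * \<eta>H1 t\<bar>) \<le> mu1 I}"

definition path_cost :: "('x, 'u) dispatch \<Rightarrow> demand \<Rightarrow> ('x, 'u) arc list \<Rightarrow> ereal" where
  "path_cost I \<xi> p = sum_list (map (weight I \<xi>) p)"

definition robust_cost :: "('x, 'u) dispatch \<Rightarrow> ('x, 'u) arc list \<Rightarrow> ereal" where
  "robust_cost I p = (SUP \<xi>\<in>demand_set I. path_cost I \<xi> p)"

definition robust_solution :: "('x, 'u) dispatch \<Rightarrow> ereal \<Rightarrow> ('x, 'u) arc list \<Rightarrow> bool" where
  "robust_solution I v p \<longleftrightarrow>
     p \<in> PATH I \<and> v = robust_cost I p \<and> (\<forall>p'\<in>PATH I. robust_cost I p \<le> robust_cost I p')"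

definition bias_demand :: "('x, 'u) dispatch \<Rightarrow> demand" where
  "bias_demand I = (\<lambda>t. P_nom I t + Delta_P I t, \<lambda>t. H_nom I t + Delta_H I t)"

definition spike_P :: "('x, 'u) dispatch \<Rightarrow> nat \<Rightarrow> demand" where
  "spike_P I k =
     (\<lambda>t. fst (bias_demand I) t + (if k = t then mu1 I / delta_P I t else 0),
      snd (bias_demand I))"

definition spike_H :: "('x, 'u) dispatch \<Rightarrow> nat \<Rightarrow> demand" where
  "spike_H I k =
     (fst (bias_demand I),
      \<lambda>t. snd (bias_demand I) t + (if k = t then mu1 I / delta_H I t else 0))"

definition W_bias :: "('x, 'u) dispatch \<Rightarrow> ('x, 'u) arc \<Rightarrow> ereal" where
  "W_bias I e = weight I (bias_demand I) e"

text \<open>If \<^term>\<open>W_bias I e\<close> is infinite, then the difference below is infinite, by the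
  convention of the library for the difference of two infinities.\<close>

definition W_spike :: "('x, 'u) dispatch \<Rightarrow> ('x, 'u) arc \<Rightarrow> ereal" where
  "W_spike I e = (case e of
       Trans t x u \<Rightarrow>
         Max ((\<lambda>k. max (weight I (spike_P I k) e) (weight I (spike_H I k) e))
                ` {t..<t + duration I x u}) - W_bias I e
     | _ \<Rightarrow> undefined)"

text \<open>A utility cost that is infinite on an interval unbounded below (power cannot be sold) can
  make an arc infeasible for a low demand and feasible for the bias and spike demands. The
  quantities \<^const>\<open>W_bias\<close> and \<^const>\<open>W_spike\<close> do not detect this. The condition below
  excludes it: an arc that is feasible for the bias demand stays feasible for all smaller demands
  of the uncertainty set.\<close>

definition downward_feasible :: "('x, 'u) dispatch \<Rightarrow> bool" where
  "downward_feasible I \<longleftrightarrow>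
     (\<forall>e\<in>arcs (dispatch_graph I). W_bias I e < \<infinity> \<longrightarrow>
        (\<forall>\<xi>\<in>demand_set I.
           (\<forall>t\<in>{1..horizon I}.
              fst \<xi> t \<le> fst (bias_demand I) t \<and> snd \<xi> t \<le> snd (bias_demand I) t) \<longrightarrow>
           weight I \<xi> e < \<infinity>))"

lemma downward_feasible_if_finite:
  assumes "\<And>t x. t \<in> {1..horizon I} \<Longrightarrow> C_power I t x < \<infinity>"
    and "\<And>t x. t \<in> {1..horizon I} \<Longrightarrow> C_heat I t x < \<infinity>"
  shows "downward_feasible I"
proof -
  have "weight I \<xi> e < \<infinity>" if e: "e \<in> arcs (dispatch_graph I)" for \<xi> e
  proof (cases e)
    case (Trans t x u)
    have "C_power I \<tau> a + C_heat I \<tau> b \<noteq> \<infinity>" if "\<tau> \<in> {t..<t + duration I x u}" for \<tau> a b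
    proof -
      have "\<tau> \<in> {1..horizon I}" using e Trans that by (auto simp: dispatch_graph_def)
      then show ?thesis using assms by (simp add: less_top [symmetric] top_ereal_def)
    qed
    then show ?thesis
      unfolding Trans by (auto simp: sum_Pinfty)
  qed auto
  then show ?thesis by (simp add: downward_feasible_def)
qed

section \<open>Algorithm A\<close>

definition Thresh :: "('x, 'u) dispatch \<Rightarrow> ereal set" where
  "Thresh I = W_spike I ` {e \<in> arcs (dispatch_graph I). is_Trans e}"

definition threshold_weight :: "('x, 'u) dispatch \<Rightarrow> ereal \<Rightarrow> ('x, 'u) arc \<Rightarrow> ereal" where
  "threshold_weight I \<alpha> e = (if is_Trans e \<and> W_spike I e > \<alpha> then \<infinity> else W_bias I e)"

definition max_spike :: "('x, 'u) dispatch \<Rightarrow> ('x, 'u) arc list \<Rightarrow> ereal" where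
  "max_spike I p = Max (W_spike I ` {e \<in> set p. is_Trans e})"

definition shortest_path ::
  "('x, 'u) dispatch \<Rightarrow> ereal \<Rightarrow> ('x, 'u) arc list \<Rightarrow> bool" where
  "shortest_path I \<alpha> p \<longleftrightarrow> p \<in> PATH I \<and>
     (\<forall>p'\<in>PATH I.
        let c = sum_list (map (threshold_weight I \<alpha>) p);
            c' = sum_list (map (threshold_weight I \<alpha>) p')
        in c < c' \<or> c = c' \<and> max_spike I p \<le> max_spike I p')"

definition V_cost :: "('x, 'u) dispatch \<Rightarrow> ('x, 'u) arc list \<Rightarrow> ereal" where
  "V_cost I p = sum_list (map (W_bias I) p) + max_spike I p"

text \<open>The algorithm leaves open which of several optimal paths and which minimising threshold
  it takes. The relation holds for every output that some choice produces.\<close>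

definition algorithm_A ::
  "('x, 'u) dispatch \<Rightarrow> ereal \<Rightarrow> ('x, 'u) arc list \<Rightarrow> bool" where
  "algorithm_A I v p \<longleftrightarrow>
     (\<exists>V_path \<gamma>.
        (\<forall>\<alpha>\<in>Thresh I. shortest_path I \<alpha> (V_path \<alpha>)) \<and>
        \<gamma> \<in> Thresh I \<and> (\<forall>\<beta>\<in>Thresh I. V_cost I (V_path \<gamma>) \<le> V_cost I (V_path \<beta>)) \<and>
        v = V_cost I (V_path \<gamma>) \<and> p = V_path \<gamma>)"

section \<open>An implementation with a step count\<close>

text \<open>The machine model is a real RAM. One step pays for an expression of bounded size: arithmetic
  and comparison of extended reals, lookup of a datum of the instance (in particular one value of
  a utility cost, or of one of the demand profiles \<^const>\<open>bias_demand\<close>, \<^const>\<open>spike_P\<close>,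
  \<^const>\<open>spike_H\<close>), access to an array indexed by the vertices, and construction or inspection of
  one list cell.\<close>

datatype 'a timed = Timed (result: 'a) (steps: nat)

definition bind_timed :: "'a timed \<Rightarrow> ('a \<Rightarrow> 'b timed) \<Rightarrow> 'b timed" where
  "bind_timed m k =
     (case m of Timed a s \<Rightarrow> (case k a of Timed b s' \<Rightarrow> Timed b (s + s')))"

adhoc_overloading Monad_Syntax.bind \<rightleftharpoons> bind_timed

definition step :: "'a \<Rightarrow> 'a timed" where
  "step a = Timed a 1"

primrec foldT :: "('b \<Rightarrow> 'a \<Rightarrow> 'b timed) \<Rightarrow> 'b \<Rightarrow> 'a list \<Rightarrow> 'b timed" where
  "foldT g b [] = step b"
| "foldT g b (a # as) = do { b' \<leftarrow> g b a; c \<leftarrow> foldT g b' as; step c }"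

definition weightT :: "('x, 'u) dispatch \<Rightarrow> demand \<Rightarrow> ('x, 'u) arc \<Rightarrow> ereal timed" where
  "weightT I \<xi> e = (case e of
       Trans t x u \<Rightarrow>
         foldT
           (\<lambda>s \<tau>. step (s + (C_power I \<tau> (fst \<xi> \<tau> - P_MGT I x u) +
                             C_heat I \<tau> (snd \<xi> \<tau> - H_MGT I x u))))
           (ereal (C_MGT I x u)) [t..<t + duration I x u]
     | _ \<Rightarrow> step 0)"

text \<open>The arcs at the source and the terminal get the spike value minus infinity, which is neutral
  for maxima and below all thresholds.\<close>

definition spikeT :: "('x, 'u) dispatch \<Rightarrow> ereal \<Rightarrow> ('x, 'u) arc \<Rightarrow> ereal timed" where
  "spikeT I b e = (case e of
       Trans t x u \<Rightarrow> do {
         m \<leftarrow> foldT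
           (\<lambda>m k. do {
              wP \<leftarrow> weightT I (spike_P I k) e;
              wH \<leftarrow> weightT I (spike_H I k) e;
              step (max m (max wP wH)) })
           (-\<infinity>) [t..<t + duration I x u];
         step (m - b) }
     | _ \<Rightarrow> step (-\<infinity>))"

type_synonym ('x, 'u) warc = "('x, 'u) arc \<times> ereal \<times> ereal"

definition annotateT ::
  "('x, 'u) dispatch \<Rightarrow> ('x, 'u) arc list \<Rightarrow> ('x, 'u) warc list timed" where
  "annotateT I es =
     foldT
       (\<lambda>as e. do {
          b \<leftarrow> weightT I (bias_demand I) e;
          s \<leftarrow> spikeT I b e;
          step ((e, b, s) # as) })
       [] es"

text \<open>Sorting the arcs by the time of their tails is a topological sort.\<close>

primrec arc_time :: "('x, 'u) dispatch \<Rightarrow> ('x, 'u) arc \<Rightarrow> nat" where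
  "arc_time I (Depart x) = 0"
| "arc_time I (Trans t x u) = t"
| "arc_time I (Arrive x) = horizon I"

primrec insertT ::
  "('x, 'u) dispatch \<Rightarrow> ('x, 'u) warc \<Rightarrow> ('x, 'u) warc list \<Rightarrow> ('x, 'u) warc list timed" where
  "insertT I a [] = step [a]"
| "insertT I a (b # bs) =
     (if arc_time I (fst a) \<le> arc_time I (fst b) then step (a # b # bs)
      else do { cs \<leftarrow> insertT I a bs; step (b # cs) })"

definition sortT ::
  "('x, 'u) dispatch \<Rightarrow> ('x, 'u) warc list \<Rightarrow> ('x, 'u) warc list timed" where
  "sortT I as = foldT (\<lambda>bs a. insertT I a bs) [] as"

text \<open>A label holds the length of a path from the source, the largest spike value on it, and the
  path itself, last arc first. Vertices not yet reached have no label.\<close>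

type_synonym ('x, 'u) label = "ereal \<times> ereal \<times> ('x, 'u) warc list"

type_synonym ('x, 'u) labelling = "'x vertex \<Rightarrow> ('x, 'u) label option"

definition better_label :: "('x, 'u) label \<Rightarrow> ('x, 'u) label \<Rightarrow> bool" where
  "better_label l l' \<longleftrightarrow> (case (l, l') of ((d, m, _), (d', m', _)) \<Rightarrow> d < d' \<or> d = d' \<and> m < m')"

definition relaxT ::
  "('x, 'u) dispatch \<Rightarrow> (ereal \<Rightarrow> ereal \<Rightarrow> ereal) \<Rightarrow> ('x, 'u) labelling \<Rightarrow> ('x, 'u) warc \<Rightarrow>
     ('x, 'u) labelling timed" where
  "relaxT I \<omega> lab a = (case a of (e, b, s) \<Rightarrow>
     (case lab (arc_tail I e) of
        None \<Rightarrow> step lab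
      | Some (d, m, p) \<Rightarrow>
          let l = (d + \<omega> b s, max m s, a # p); v = arc_head I e in
          (case lab v of
             None \<Rightarrow> step (lab(v := Some l))
           | Some l' \<Rightarrow> if better_label l l' then step (lab(v := Some l)) else step lab)))"

text \<open>The array of labels is allocated with arbitrary contents. Only the entries for end points of
  arcs, the source and the terminal are initialised.\<close>

definition scanT ::
  "('x, 'u) dispatch \<Rightarrow> (ereal \<Rightarrow> ereal \<Rightarrow> ereal) \<Rightarrow> ('x, 'u) warc list \<Rightarrow>
     ('x, 'u) label option timed" where
  "scanT I \<omega> as = do {
     lab \<leftarrow> foldT
       (\<lambda>lab (e, b, s). step (lab(arc_tail I e := None, arc_head I e := None)))
       (\<lambda>_. undefined) as;
     lab' \<leftarrow> step (lab(Source := Some (0, -\<infinity>, []), Terminal := None));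
     lab'' \<leftarrow> foldT (relaxT I \<omega>) lab' as;
     step (lab'' Terminal) }"

text \<open>If the shortest length is infinite, then all paths tie, and a second scan finds the path with
  the lowest maximal spike value among all paths. Comparing labels lexicographically in a single
  scan would not achieve this, since an infinite arc weight makes unequal lengths equal.\<close>

definition shortestT ::
  "('x, 'u) dispatch \<Rightarrow> ereal \<Rightarrow> ('x, 'u) warc list \<Rightarrow> ('x, 'u) label option timed" where
  "shortestT I \<alpha> as = do {
     l \<leftarrow> scanT I (\<lambda>b s. if s \<le> \<alpha> then b else \<infinity>) as;
     case l of
       None \<Rightarrow> step None
     | Some (d, m, p) \<Rightarrow> if d = \<infinity> then scanT I (\<lambda>b s. 0) as else step l }"

definition valueT :: "('x, 'u) warc list \<Rightarrow> ereal timed" where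
  "valueT p = do {
     BS \<leftarrow> foldT (\<lambda>BS a. step (fst BS + fst (snd a), max (snd BS) (snd (snd a)))) (0, -\<infinity>) p;
     step (fst BS + snd BS) }"

definition algorithmT ::
  "('x, 'u) dispatch \<Rightarrow> ('x, 'u) arc list \<Rightarrow> (ereal \<times> ('x, 'u) arc list) option timed" where
  "algorithmT I es = do {
     ws \<leftarrow> annotateT I es;
     as \<leftarrow> sortT I ws;
     best \<leftarrow> foldT
       (\<lambda>best (e, b, \<alpha>).
          if is_Trans e then do {
            l \<leftarrow> shortestT I \<alpha> as;
            case l of
              None \<Rightarrow> step best
            | Some (d, m, p) \<Rightarrow> do {
                v \<leftarrow> valueT p;
                case best of
                  None \<Rightarrow> step (Some (v, p))
                | Some (v', p') \<Rightarrow> step (if v < v' then Some (v, p) else best) } }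
          else step best)
       None as;
     case best of
       None \<Rightarrow> step None
     | Some (v, p) \<Rightarrow> do {
         q \<leftarrow> foldT (\<lambda>q a. step (fst a # q)) [] p;
         step (Some (v, q)) } }"

end

theory Submission
  imports Defs
begin

text \<open>
The transitions on a path from the source to the terminal occupy disjoint time intervals, so the
cost of the path is a constant plus a sum of convex functions, each of one demand at one time.
Over the uncertainty set such a sum is largest at an extreme point. By monotonicity the box
contributes its upper corner, the bias demand, and the weighted ball contributes a vertex with
positive sign, that is a spike which spends the whole budget on one commodity at one time. The
spike meets at most one arc of the path, hence the worst case of a path with a transition is the
sum of the values \<^const>\<open>W_bias\<close> plus the largest value \<^const>\<open>W_spike\<close>, which is \<^const>\<open>V_cost\<close>
(\<open>robust_cost_eq_V_cost\<close>). The upper bound is proved without extreme points: a noise vector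
splits the budget into nonnegative shares with sum at most one, a share \<open>l\<close> of the budget raises
a utility cost by at most \<open>l\<close> times the rise caused by the full spike
(\<open>utility_cost_spread\<close>), and along a path these rises add up to at most the largest spike
(\<open>path_cost_le_V_cost\<close>). Infinite costs fit in: an arc with infinite bias has an infinite spike
value, and an arc with finite bias stays finite for low demands by \<^const>\<open>downward_feasible\<close>.

Minimising a sum plus a maximum reduces to shortest paths by guessing the maximum. For any path
\<open>p'\<close>, the threshold \<^term>\<open>max_spike I p'\<close> leaves the weights of \<open>p'\<close> unchanged, and a shortest
path for this threshold is at most as long as \<open>p'\<close> and, if its length is finite, contains no arc
with a larger spike (\<open>shortest_path_max_spike_optimal\<close>). So the best output over all thresholds
is at least as good as every path.

For the implementation, time increases along every arc. Sorting the arcs by the times of their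
tails is therefore a topological sort, and a single scan leaves at each vertex a label that is
lexicographically at least as good as every walk of finite length from the source to it
(\<open>labels_correct\<close>); if all paths are infinitely long, a second scan settles the tie. A scan
takes linear time, and each arc causes at most two of them, which gives the quadratic bound;
the insertion sort is quadratic as well, and a bound on the durations makes the computation of the
bias and the spike of an arc a constant number of steps.
\<close>

section \<open>Extended reals and utility costs\<close>

lemma sum_not_MInfty:
  fixes f :: "'a \<Rightarrow> ereal"
  assumes "\<And>i. i \<in> S \<Longrightarrow> f i \<noteq> -\<infinity>"
  shows "sum f S \<noteq> -\<infinity>"
  using assms by (induction S rule: infinite_finite_induct) auto

lemma sum_list_PInfty:
  fixes f :: "'a \<Rightarrow> ereal"
  shows "sum_list (map f as) = \<infinity> \<longleftrightarrow> (\<exists>a\<in>set as. f a = \<infinity>)"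
  by (induction as) auto

lemma utility_cost_not_MInfty: "utility_cost C \<Longrightarrow> C x \<noteq> -\<infinity>"
  by (simp add: utility_cost_def)

lemma utility_cost_mono:
  assumes "utility_cost C" "C x \<noteq> \<infinity>" "x \<le> y"
  shows "C x \<le> C y"
proof (cases "C y = \<infinity>")
  case False
  with assms show ?thesis
    unfolding utility_cost_def by (auto dest!: mono_onD [of _ C x y])
qed simp

lemma utility_cost_between:
  assumes C: "utility_cost C" and fin: "C x \<noteq> \<infinity>" "C z \<noteq> \<infinity>" and le: "x \<le> y" "y \<le> z"
  shows "C y \<noteq> \<infinity>"
proof (cases "y = x \<or> y = z")
  case False
  define l where "l = (y - x) / (z - x)"
  have l: "0 < l" "l < 1" and y: "(1 - l) * x + l * z = y"
  proof -
    have less: "x < y" "y < z" using False le by auto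
    then show "0 < l" "l < 1" by (simp_all add: l_def)
    have "l * (z - x) = y - x" using less by (simp add: l_def)
    then show "(1 - l) * x + l * z = y" by (simp add: algebra_simps)
  qed
  then have "C y \<le> ereal (1 - l) * C x + ereal l * C z"
    using C unfolding utility_cost_def by metis
  moreover have "\<dots> \<noteq> \<infinity>"
    using fin utility_cost_not_MInfty [OF C] by (cases "C x"; cases "C z") auto
  ultimately show ?thesis by auto
qed (use fin in auto)

text \<open>This is where convexity enters. On the segment from \<open>b\<close> to \<open>b + s\<close> the graph of \<open>C\<close> lies below
its chord, which rises by at most \<open>M\<close>, and monotonicity extends the bound to all smaller
arguments at which \<open>C\<close> is finite. That finiteness has to be assumed below \<open>b\<close>, because \<open>C\<close> may be
infinite on an interval unbounded below.\<close>

lemma utility_cost_spread: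
  assumes C: "utility_cost C" and b: "C b = ereal cb" and s: "C (b + s) \<le> ereal (cb + M)"
    and low: "y \<le> b \<Longrightarrow> C y \<noteq> \<infinity>"
    and y: "y \<le> b + l * s" and l: "0 \<le> l" "l \<le> 1" and "0 \<le> s" "0 \<le> M"
  shows "C y \<le> ereal (cb + l * M)"
proof (cases "y \<le> b")
  case True
  then have "C y \<le> C b"
    using C low by (intro utility_cost_mono)
  also have "\<dots> \<le> ereal (cb + l * M)"
    using b l \<open>0 \<le> M\<close> by simp
  finally show ?thesis .
next
  case False
  obtain cs where cs: "C (b + s) = ereal cs" "cs \<le> cb + M"
    using s utility_cost_not_MInfty [OF C, of "b + s"] by (cases "C (b + s)") auto
  have line: "C (b + l * s) \<le> ereal (cb + l * (cs - cb))"
  proof (cases "l = 0 \<or> l = 1")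
    case True
    then show ?thesis using b cs by auto
  next
    case False
    then have "0 < l" "l < 1" using l by auto
    then have "C ((1 - l) * b + l * (b + s)) \<le> ereal (1 - l) * C b + ereal l * C (b + s)"
      using C unfolding utility_cost_def by blast
    moreover have "(1 - l) * b + l * (b + s) = b + l * s"
      by (simp add: algebra_simps)
    ultimately show ?thesis
      using b cs by (simp add: algebra_simps)
  qed
  moreover have "C y \<le> C (b + l * s)"
  proof -
    have "C (b + l * s) \<noteq> \<infinity>" using line by auto
    then have "C y \<noteq> \<infinity>"
      using utility_cost_between [OF C, of b "b + l * s" y] b False y by simp
    then show ?thesis using utility_cost_mono [OF C] y by blast
  qed
  moreover have "l * (cs - cb) \<le> l * M"
    using l cs by (intro mult_left_mono) auto
  ultimately show ?thesis
    by (meson add_left_mono ereal_less_eq(3) order_trans)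
qed

lemma finite_ereal: "y \<noteq> \<infinity> \<Longrightarrow> y \<noteq> -\<infinity> \<Longrightarrow> y = ereal (real_of_ereal y)"
  by (cases y) simp_all

section \<open>Time increases along the arcs\<close>

locale valid_instance =
  fixes I :: "('x, 'u) dispatch"
  assumes valid: "valid_dispatch I"
begin

abbreviation "G \<equiv> dispatch_graph I"

lemma finite_states: "finite (states I)"
  and finite_controls: "x \<in> states I \<Longrightarrow> finite (controls I x)"
  and successor_in: "x \<in> states I \<Longrightarrow> u \<in> controls I x \<Longrightarrow> successor I x u \<in> states I"
  and duration_pos: "x \<in> states I \<Longrightarrow> u \<in> controls I x \<Longrightarrow> 1 \<le> duration I x u"
  and horizon_pos: "1 \<le> horizon I"
  and mu1_nonneg: "0 \<le> mu1 I"
  and utility_costs: "t \<in> {1..horizon I} \<Longrightarrow> utility_cost (C_power I t)"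
    "t \<in> {1..horizon I} \<Longrightarrow> utility_cost (C_heat I t)"
  and Delta_nonneg: "t \<in> {1..horizon I} \<Longrightarrow> 0 \<le> Delta_P I t"
    "t \<in> {1..horizon I} \<Longrightarrow> 0 \<le> Delta_H I t"
  and delta_pos: "t \<in> {1..horizon I} \<Longrightarrow> 0 < delta_P I t"
    "t \<in> {1..horizon I} \<Longrightarrow> 0 < delta_H I t"
  using valid unfolding valid_dispatch_def by blast+

lemma G_simps [simp]:
  "verts G = {Node t x |t x. t \<in> {1..horizon I} \<and> x \<in> states I} \<union> {Source, Terminal}"
  "tail G = arc_tail I" "head G = arc_head I"
  by (simp_all add: dispatch_graph_def)

lemma arc_cases:
  assumes "e \<in> arcs G"
  obtains (Depart) x where "e = Depart x" "x \<in> states I"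
  | (Trans) t x u where "e = Trans t x u" "1 \<le> t" "x \<in> states I" "u \<in> controls I x"
      "1 \<le> duration I x u" "t + duration I x u \<le> horizon I"
  | (Arrive) x where "e = Arrive x" "x \<in> states I"
  using assms duration_pos by (auto simp: dispatch_graph_def)

sublocale fin_digraph G
proof
  have "verts G = (\<lambda>(t, x). Node t x) ` ({1..horizon I} \<times> states I) \<union> {Source, Terminal}"
    by auto
  then show "finite (verts G)"
    using finite_states by simp
  have "arcs G \<subseteq> Depart ` states I \<union> Arrive ` states I \<union>
      (\<lambda>(t, x, u). Trans t x u) ` ({1..horizon I} \<times> (SIGMA x : states I. controls I x))"
    by (auto simp: dispatch_graph_def image_iff)
  moreover have "finite \<dots>"
    using finite_states finite_controls by auto
  ultimately show "finite (arcs G)"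
    by (rule finite_subset)
next
  fix e assume "e \<in> arcs G"
  then show "tail G e \<in> verts G" "head G e \<in> verts G"
    using horizon_pos successor_in by (auto elim!: arc_cases)
qed

text \<open>The source precedes all times and the terminal follows them, so that the time of the tail of an
arc is always less than the time of its head.\<close>

primrec vertex_time :: "'x vertex \<Rightarrow> nat" where
  "vertex_time Source = 0"
| "vertex_time (Node t x) = t"
| "vertex_time Terminal = Suc (horizon I)"

lemma vertex_time_tail: "e \<in> arcs G \<Longrightarrow> vertex_time (arc_tail I e) = arc_time I e"
  by (auto elim!: arc_cases)

lemma arc_time_less_head: "e \<in> arcs G \<Longrightarrow> arc_time I e < vertex_time (arc_head I e)"
  by (auto elim!: arc_cases)

lemma awalk_times:
  assumes "awalk u p v"
  shows "vertex_time u \<le> vertex_time v"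
    and "e \<in> set p \<Longrightarrow> vertex_time u \<le> arc_time I e \<and> arc_time I e < vertex_time v"
proof -
  have "vertex_time u \<le> vertex_time v \<and>
    (\<forall>e\<in>set p. vertex_time u \<le> arc_time I e \<and> arc_time I e < vertex_time v)"
    using assms
  proof (induction p arbitrary: u)
    case (Cons a p)
    then have a: "a \<in> arcs G" "arc_tail I a = u" and walk: "awalk (arc_head I a) p v"
      by (simp_all add: awalk_Cons_iff)
    have "vertex_time u = arc_time I a" "arc_time I a < vertex_time (arc_head I a)"
      using vertex_time_tail arc_time_less_head a by auto
    with Cons.IH [OF walk] show ?case by force
  qed (simp add: awalk_Nil_iff)
  then show "vertex_time u \<le> vertex_time v"
    and "e \<in> set p \<Longrightarrow> vertex_time u \<le> arc_time I e \<and> arc_time I e < vertex_time v"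
    by auto
qed

text \<open>The times of the vertices on a walk increase strictly, so nothing can repeat; in this graph
walks and paths are the same.\<close>

lemma awalk_distinct:
  assumes "awalk u p v"
  shows "distinct p" "distinct (awalk_verts u p)"
proof -
  have "distinct p \<and> distinct (awalk_verts u p)"
    using assms
  proof (induction p arbitrary: u)
    case (Cons a p)
    then have a: "a \<in> arcs G" "arc_tail I a = u" and walk: "awalk (arc_head I a) p v"
      by (simp_all add: awalk_Cons_iff)
    have less: "vertex_time u = arc_time I a" "arc_time I a < vertex_time (arc_head I a)"
      using vertex_time_tail arc_time_less_head a by auto
    have "set (awalk_verts (arc_head I a) p) \<subseteq> insert (arc_head I a) (arc_head I ` set p)"
      using awalk_verts_conv' [of "arc_head I a" p v] walk
      by (cases p) (simp_all add: awalk_def)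
    moreover have "vertex_time (arc_head I a) < vertex_time (arc_head I b)" if "b \<in> set p" for b
    proof -
      have "b \<in> arcs G" using that walk by (auto simp: awalk_def)
      then show ?thesis
        using awalk_times(2) [OF walk that] arc_time_less_head [of b] by simp
    qed
    ultimately have "u \<notin> set (awalk_verts (arc_head I a) p)"
      using less by fastforce
    moreover have "a \<notin> set p"
      using awalk_times(2) [OF walk, of a] less by auto
    ultimately show ?case
      using Cons.IH [OF walk] a by simp
  qed (simp add: awalk_Nil_iff)
  then show "distinct p" "distinct (awalk_verts u p)" by auto
qed

lemma PATH_eq: "PATH I = {p. awalk Source p Terminal}"
  unfolding PATH_def apath_def using awalk_distinct(2) by blast

lemma finite_PATH: "finite (PATH I)"
  unfolding PATH_def by (rule apaths_finite)

lemma PATH_arcs: "p \<in> PATH I \<Longrightarrow> e \<in> set p \<Longrightarrow> e \<in> arcs G"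
  by (auto simp: PATH_eq)

lemma PATH_has_Trans:
  assumes "2 \<le> horizon I" "p \<in> PATH I"
  shows "\<exists>e\<in>set p. is_Trans e"
proof (rule ccontr)
  assume no: "\<not> ?thesis"
  obtain a p' where p: "p = a # p'" "a \<in> arcs G" "arc_tail I a = Source"
      "awalk (arc_head I a) p' Terminal"
    using assms(2) by (cases p) (auto simp: PATH_eq awalk_Nil_iff awalk_Cons_iff)
  from p(2,3) obtain x where x: "arc_head I a = Node 1 x"
    by (auto elim!: arc_cases)
  then obtain b where b: "b \<in> set p'" "b \<in> arcs G" "arc_tail I b = Node 1 x"
    using p(4) by (cases p') (auto simp: awalk_Nil_iff awalk_Cons_iff)
  then show False
    using no assms(1) p(1) by (auto elim!: arc_cases)
qed

lemma Trans_imp_horizon: "e \<in> arcs G \<Longrightarrow> is_Trans e \<Longrightarrow> 2 \<le> horizon I"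
  by (auto elim!: arc_cases)

text \<open>The time steps at which the costs of an arc are incurred. The arcs at the source and the
terminal incur none.\<close>

primrec arc_steps :: "('x, 'u) arc \<Rightarrow> nat set" where
  "arc_steps (Depart x) = {}"
| "arc_steps (Trans t x u) = {t..<t + duration I x u}"
| "arc_steps (Arrive x) = {}"

lemma arc_steps_subset: "e \<in> arcs G \<Longrightarrow> arc_steps e \<subseteq> {1..horizon I}"
  by (auto elim!: arc_cases)

text \<open>The time steps of the arcs on a walk are pairwise disjoint, since each arc ends where the next
one begins. Applied to the shares of the noise budget, this bounds by one the shares that a whole
path absorbs.\<close>

lemma sum_steps_le:
  fixes share :: "nat \<Rightarrow> real"
  assumes "awalk u p v" and "\<And>t. 0 \<le> share t"
  shows "(\<Sum>e\<leftarrow>p. sum share (arc_steps e)) \<le> sum share {vertex_time u..horizon I}"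
  using assms(1)
proof (induction p arbitrary: u)
  case Nil
  show ?case by (simp add: sum_nonneg assms(2))
next
  case (Cons a p)
  then have a: "a \<in> arcs G" "arc_tail I a = u" and walk: "awalk (arc_head I a) p v"
    by (simp_all add: awalk_Cons_iff)
  have time: "vertex_time u = arc_time I a"
    using vertex_time_tail a by auto
  have "sum share (arc_steps a) + sum share {vertex_time (arc_head I a)..horizon I} =
      sum share (arc_steps a \<union> {vertex_time (arc_head I a)..horizon I})"
    using a(1) by (intro sum.union_disjoint [symmetric]) (auto elim!: arc_cases)
  also have "\<dots> \<le> sum share {vertex_time u..horizon I}"
    using a(1) unfolding time by (intro sum_mono2) (auto elim!: arc_cases simp: assms(2))
  finally show ?case
    using Cons.IH [OF walk] by simp
qed

section \<open>Bias and spike of an arc\<close>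

lemma arc_utility_costs:
  assumes "e \<in> arcs G" "\<tau> \<in> arc_steps e"
  shows "utility_cost (C_power I \<tau>)" "utility_cost (C_heat I \<tau>)"
  using assms arc_steps_subset utility_costs by blast+

lemma weight_not_MInfty: "e \<in> arcs G \<Longrightarrow> weight I \<xi> e \<noteq> -\<infinity>"
  using arc_utility_costs [of e] by (cases e) (auto simp: utility_cost_not_MInfty intro!: sum_not_MInfty)

lemma weight_finite_iff:
  assumes "Trans t x u \<in> arcs G"
  shows "weight I \<xi> (Trans t x u) \<noteq> \<infinity> \<longleftrightarrow> (\<forall>\<tau>\<in>arc_steps (Trans t x u).
    C_power I \<tau> (fst \<xi> \<tau> - P_MGT I x u) \<noteq> \<infinity> \<and> C_heat I \<tau> (snd \<xi> \<tau> - H_MGT I x u) \<noteq> \<infinity>)"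
  by (auto simp: sum_Pinfty)

text \<open>Raising the demand above the bias cannot lower the weight: a utility cost that is finite at the
bias is monotone to the right of it, where it is either finite or infinite. If the bias weight is
infinite, a higher demand may well have a finite weight, as when power cannot be sold.\<close>

lemma W_bias_le_weight:
  assumes e: "e \<in> arcs G" and fin: "W_bias I e \<noteq> \<infinity>"
    and ge: "\<And>\<tau>. fst (bias_demand I) \<tau> \<le> fst \<xi> \<tau>" "\<And>\<tau>. snd (bias_demand I) \<tau> \<le> snd \<xi> \<tau>"
  shows "W_bias I e \<le> weight I \<xi> e"
proof (cases e)
  case (Trans t x u)
  note fin' = fin [unfolded W_bias_def Trans, unfolded weight_finite_iff [OF e [unfolded Trans]]]
  show ?thesis
    unfolding W_bias_def Trans weight.simps
    using arc_utility_costs [OF e] fin' ge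
    by (intro add_mono sum_mono order_refl utility_cost_mono) (auto simp: Trans)
qed (simp_all add: W_bias_def)

lemma mu1_div_nonneg:
  assumes "t \<in> {1..horizon I}"
  shows "0 \<le> mu1 I / delta_P I t" "0 \<le> mu1 I / delta_H I t"
  using assms mu1_nonneg delta_pos [of t] by simp_all

lemma spike_ge_bias:
  assumes "k \<in> {1..horizon I}"
  shows "fst (bias_demand I) \<tau> \<le> fst (spike_P I k) \<tau>" "snd (bias_demand I) \<tau> \<le> snd (spike_P I k) \<tau>"
    "fst (bias_demand I) \<tau> \<le> fst (spike_H I k) \<tau>" "snd (bias_demand I) \<tau> \<le> snd (spike_H I k) \<tau>"
  using mu1_div_nonneg [OF assms] by (auto simp: spike_P_def spike_H_def)

text \<open>If the bias weight is infinite, then some utility cost is infinite at the bias demand, and a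
spike in the other commodity does not remove it.\<close>

lemma infinite_bias_spike:
  assumes e: "e \<in> arcs G" and inf: "W_bias I e = \<infinity>"
  shows "\<exists>k\<in>arc_steps e. weight I (spike_P I k) e = \<infinity> \<or> weight I (spike_H I k) e = \<infinity>"
proof (cases e)
  case (Trans t x u)
  then obtain \<tau> where \<tau>: "\<tau> \<in> arc_steps e"
    "C_power I \<tau> (fst (bias_demand I) \<tau> - P_MGT I x u) = \<infinity> \<or>
     C_heat I \<tau> (snd (bias_demand I) \<tau> - H_MGT I x u) = \<infinity>"
    using inf weight_finite_iff [of t x u "bias_demand I"] e by (auto simp: W_bias_def)
  then have "weight I (spike_H I \<tau>) e = \<infinity> \<or> weight I (spike_P I \<tau>) e = \<infinity>"
    using Trans by (auto simp: sum_Pinfty spike_P_def spike_H_def)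
  then show ?thesis using \<tau>(1) by blast
qed (use inf in \<open>simp_all add: W_bias_def\<close>)

lemma arc_steps_finite: "finite (arc_steps e)"
  by (cases e) auto

lemma arc_steps_nonempty: "e \<in> arcs G \<Longrightarrow> is_Trans e \<Longrightarrow> arc_steps e \<noteq> {}"
  by (auto elim!: arc_cases)

text \<open>The minuend in the definition of \<^const>\<open>W_spike\<close>.\<close>

definition peak :: "('x, 'u) arc \<Rightarrow> ereal" where
  "peak e = Max ((\<lambda>k. max (weight I (spike_P I k) e) (weight I (spike_H I k) e)) ` arc_steps e)"

lemma W_spike_eq: "is_Trans e \<Longrightarrow> W_spike I e = peak e - W_bias I e"
  by (cases e) (simp_all add: W_spike_def peak_def del: weight.simps)

lemma le_peak:
  assumes "k \<in> arc_steps e" "\<xi> \<in> {spike_P I k, spike_H I k}"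
  shows "weight I \<xi> e \<le> peak e"
proof -
  have "max (weight I (spike_P I k) e) (weight I (spike_H I k) e) \<le> peak e"
    unfolding peak_def using assms(1) arc_steps_finite by (intro Max_ge) auto
  then show ?thesis
    using assms(2) by auto
qed

lemma infinite_W_spike:
  assumes "e \<in> arcs G" "is_Trans e" "W_bias I e = \<infinity>"
  shows "W_spike I e = \<infinity>"
proof -
  have "peak e = \<infinity>"
    using infinite_bias_spike [OF assms(1,3)] le_peak by (metis ereal_infty_less_eq(1) insertI1 insert_commute)
  then show ?thesis
    using assms by (simp add: W_spike_eq)
qed

text \<open>Subtracting \<^term>\<open>W_bias I e\<close> and adding it again can go wrong only if it is infinite. In that
case the spike value is infinite too, and both sides are infinite.\<close>

lemma peak_eq:
  assumes e: "e \<in> arcs G" "is_Trans e"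
  shows "peak e = W_bias I e + W_spike I e"
proof (cases "W_bias I e = \<infinity>")
  case True
  then have "peak e = \<infinity>"
    using infinite_W_spike [OF e] W_spike_eq [OF e(2)] by (cases "peak e") auto
  then show ?thesis using True by simp
next
  case False
  moreover have "W_bias I e \<noteq> -\<infinity>"
    using weight_not_MInfty [OF e(1)] by (simp add: W_bias_def)
  ultimately show ?thesis
    unfolding W_spike_eq [OF e(2)] by (cases "W_bias I e"; cases "peak e") simp_all
qed

lemma spike_attained:
  assumes e: "e \<in> arcs G" "is_Trans e"
  obtains k \<xi> where "k \<in> arc_steps e" "\<xi> \<in> {spike_P I k, spike_H I k}"
    "weight I \<xi> e = W_bias I e + W_spike I e"
proof -
  have "peak e \<in> (\<lambda>k. max (weight I (spike_P I k) e) (weight I (spike_H I k) e)) ` arc_steps e"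
    unfolding peak_def using arc_steps_finite arc_steps_nonempty [OF e] by (intro Max_in) auto
  then obtain k where "k \<in> arc_steps e"
    "peak e = max (weight I (spike_P I k) e) (weight I (spike_H I k) e)"
    by blast
  then show ?thesis
    using that [of k "spike_P I k"] that [of k "spike_H I k"] peak_eq [OF e]
    by (auto simp: max_def split: if_splits)
qed

lemma W_spike_nonneg:
  assumes e: "e \<in> arcs G" "is_Trans e"
  shows "0 \<le> W_spike I e"
proof (cases "W_bias I e = \<infinity>")
  case True
  then show ?thesis using infinite_W_spike [OF e] by simp
next
  case False
  obtain k \<xi> where k: "k \<in> arc_steps e" "\<xi> \<in> {spike_P I k, spike_H I k}"
    and eq: "weight I \<xi> e = W_bias I e + W_spike I e"
    using spike_attained [OF e] .
  have "k \<in> {1..horizon I}" using k(1) arc_steps_subset [OF e(1)] by blast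
  then have "W_bias I e \<le> W_bias I e + W_spike I e"
    using W_bias_le_weight [OF e(1) False, of \<xi>] spike_ge_bias k(2) unfolding eq by auto
  moreover have "W_bias I e \<noteq> -\<infinity>"
    using weight_not_MInfty [OF e(1)] by (simp add: W_bias_def)
  ultimately show ?thesis
    using False by (cases "W_bias I e"; cases "W_spike I e") simp_all
qed

section \<open>Splitting the noise into shares of the budget\<close>

lemma demand_set_iff:
  "\<xi> \<in> demand_set I \<longleftrightarrow> (\<exists>nP bP nH bH.
     (\<forall>t\<in>{1..horizon I}.
        fst \<xi> t = P_nom I t + nP t + bP t \<and> snd \<xi> t = H_nom I t + nH t + bH t \<and>
        \<bar>bP t\<bar> \<le> Delta_P I t \<and> \<bar>bH t\<bar> \<le> Delta_H I t) \<and>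
     (\<Sum>t=1..horizon I. \<bar>delta_P I t * nP t\<bar> + \<bar>delta_H I t * nH t\<bar>) \<le> mu1 I)"
  by (cases \<xi>) (simp add: demand_set_def)

text \<open>The introduction rule takes the four noise components as explicit parameters, which spares the
search for witnesses.\<close>

lemma demand_setI:
  assumes "\<And>t. t \<in> {1..horizon I} \<Longrightarrow> fst \<xi> t = P_nom I t + nP t + bP t"
    "\<And>t. t \<in> {1..horizon I} \<Longrightarrow> snd \<xi> t = H_nom I t + nH t + bH t"
    "\<And>t. t \<in> {1..horizon I} \<Longrightarrow> \<bar>bP t\<bar> \<le> Delta_P I t"
    "\<And>t. t \<in> {1..horizon I} \<Longrightarrow> \<bar>bH t\<bar> \<le> Delta_H I t"
    "(\<Sum>t=1..horizon I. \<bar>delta_P I t * nP t\<bar> + \<bar>delta_H I t * nH t\<bar>) \<le> mu1 I"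
  shows "\<xi> \<in> demand_set I"
  using assms unfolding demand_set_iff by blast

text \<open>The share of a noise component is the fraction of the budget that it consumes. The part of the
demand that lies above the bias is then at most that fraction of the full spike. Outside the
horizon the shares are zero, so that they may be summed from time zero, the time of the source.\<close>

lemma demand_shares:
  assumes "\<xi> \<in> demand_set I"
  obtains sP sH :: "nat \<Rightarrow> real"
  where "\<And>t. 0 \<le> sP t" "\<And>t. 0 \<le> sH t" "(\<Sum>t=0..horizon I. sP t + sH t) \<le> 1"
    "\<And>t. t \<in> {1..horizon I} \<Longrightarrow> fst \<xi> t \<le> fst (bias_demand I) t + sP t * (mu1 I / delta_P I t)"
    "\<And>t. t \<in> {1..horizon I} \<Longrightarrow> snd \<xi> t \<le> snd (bias_demand I) t + sH t * (mu1 I / delta_H I t)"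
proof -
  obtain nP bP nH bH where
    dec: "\<forall>t\<in>{1..horizon I}.
        fst \<xi> t = P_nom I t + nP t + bP t \<and> snd \<xi> t = H_nom I t + nH t + bH t \<and>
        \<bar>bP t\<bar> \<le> Delta_P I t \<and> \<bar>bH t\<bar> \<le> Delta_H I t"
    and l1: "(\<Sum>t=1..horizon I. \<bar>delta_P I t * nP t\<bar> + \<bar>delta_H I t * nH t\<bar>) \<le> mu1 I"
    using assms unfolding demand_set_iff by blast
  define sP sH
    where "sP t = (if t \<in> {1..horizon I} then \<bar>delta_P I t * nP t\<bar> / mu1 I else 0)"
      and "sH t = (if t \<in> {1..horizon I} then \<bar>delta_H I t * nH t\<bar> / mu1 I else 0)" for t
  have "(\<Sum>t=0..horizon I. sP t + sH t) = (\<Sum>t=1..horizon I. sP t + sH t)"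
    by (intro sum.mono_neutral_right) (auto simp: sP_def sH_def)
  also have "\<dots> = (\<Sum>t=1..horizon I. \<bar>delta_P I t * nP t\<bar> + \<bar>delta_H I t * nH t\<bar>) / mu1 I"
    by (simp add: sP_def sH_def sum_divide_distrib add_divide_distrib)
  also have "\<dots> \<le> 1"
    using l1 mu1_nonneg by (cases "mu1 I = 0") (simp_all add: divide_le_eq)
  finally have sum: "(\<Sum>t=0..horizon I. sP t + sH t) \<le> 1" .
  have small: "\<bar>delta_P I t * nP t\<bar> + \<bar>delta_H I t * nH t\<bar> \<le> mu1 I" if "t \<in> {1..horizon I}" for t
  proof -
    have "\<bar>delta_P I t * nP t\<bar> + \<bar>delta_H I t * nH t\<bar>
        \<le> (\<Sum>t=1..horizon I. \<bar>delta_P I t * nP t\<bar> + \<bar>delta_H I t * nH t\<bar>)"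
      using that by (intro member_le_sum [of t _ "\<lambda>t. \<bar>delta_P I t * nP t\<bar> + \<bar>delta_H I t * nH t\<bar>"]) auto
    with l1 show ?thesis by simp
  qed
  \<comment> \<open>if the budget \<^term>\<open>mu1 I\<close> is zero, then so is the noise \<open>n\<close>, and the division by zero does no harm\<close>
  have scale: "n \<le> \<bar>d * n\<bar> / mu1 I * (mu1 I / d)" if "\<bar>d * n\<bar> \<le> mu1 I" "0 < d" for d n :: real
  proof (cases "mu1 I = 0")
    case True
    with that show ?thesis by simp
  next
    case False
    then have "\<bar>d * n\<bar> / mu1 I * (mu1 I / d) = \<bar>n\<bar>"
      using that(2) by (simp add: abs_mult)
    then show ?thesis by linarith
  qed
  show ?thesis
  proof (rule that [OF _ _ sum])
    fix t assume t: "t \<in> {1..horizon I}"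
    note small [OF t]
    then have "nP t \<le> sP t * (mu1 I / delta_P I t)" "nH t \<le> sH t * (mu1 I / delta_H I t)"
      using scale [of "delta_P I t" "nP t"] scale [of "delta_H I t" "nH t"] delta_pos [OF t] t
      by (simp_all add: sP_def sH_def)
    then show "fst \<xi> t \<le> fst (bias_demand I) t + sP t * (mu1 I / delta_P I t)"
        "snd \<xi> t \<le> snd (bias_demand I) t + sH t * (mu1 I / delta_H I t)"
      using dec t unfolding bias_demand_def fst_conv snd_conv by (smt (verit))+
  qed (simp_all add: sP_def sH_def mu1_nonneg)
qed

text \<open>Capping a demand at the bias demand stays in the uncertainty set: where the cap is effective, the
noise is replaced by its upper box bound and zero consumption of the budget. The capped demand is
one to which \<^const>\<open>downward_feasible\<close> applies.\<close>

lemma capped_demand: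
  assumes "\<xi> \<in> demand_set I"
  shows "(\<lambda>t. min (fst \<xi> t) (fst (bias_demand I) t), \<lambda>t. min (snd \<xi> t) (snd (bias_demand I) t))
    \<in> demand_set I"
proof -
  obtain nP bP nH bH where
    dec: "\<forall>t\<in>{1..horizon I}.
        fst \<xi> t = P_nom I t + nP t + bP t \<and> snd \<xi> t = H_nom I t + nH t + bH t \<and>
        \<bar>bP t\<bar> \<le> Delta_P I t \<and> \<bar>bH t\<bar> \<le> Delta_H I t"
    and l1: "(\<Sum>t=1..horizon I. \<bar>delta_P I t * nP t\<bar> + \<bar>delta_H I t * nH t\<bar>) \<le> mu1 I"
    using assms unfolding demand_set_iff by blast
  let ?p = "\<lambda>t. fst \<xi> t \<le> fst (bias_demand I) t" and ?h = "\<lambda>t. snd \<xi> t \<le> snd (bias_demand I) t"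
  let ?nP = "\<lambda>t. if ?p t then nP t else 0" and ?bP = "\<lambda>t. if ?p t then bP t else Delta_P I t"
  let ?nH = "\<lambda>t. if ?h t then nH t else 0" and ?bH = "\<lambda>t. if ?h t then bH t else Delta_H I t"
  have "(\<Sum>t=1..horizon I. \<bar>delta_P I t * ?nP t\<bar> + \<bar>delta_H I t * ?nH t\<bar>)
      \<le> (\<Sum>t=1..horizon I. \<bar>delta_P I t * nP t\<bar> + \<bar>delta_H I t * nH t\<bar>)"
    by (intro sum_mono add_mono) auto
  then have "(\<Sum>t=1..horizon I. \<bar>delta_P I t * ?nP t\<bar> + \<bar>delta_H I t * ?nH t\<bar>) \<le> mu1 I"
    using l1 by linarith
  then show ?thesis
    using dec Delta_nonneg
    by (intro demand_setI [of _ ?nP ?bP ?nH ?bH]) (auto simp: bias_demand_def)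
qed

lemma bias_in_demand_set: "bias_demand I \<in> demand_set I"
  using Delta_nonneg mu1_nonneg
  by (intro demand_setI [of _ "\<lambda>_. 0" "Delta_P I" "\<lambda>_. 0" "Delta_H I"])
    (auto simp: bias_demand_def)

lemma spikes_in_demand_set:
  assumes k: "k \<in> {1..horizon I}"
  shows "spike_P I k \<in> demand_set I" "spike_H I k \<in> demand_set I"
proof -
  have one: "(\<Sum>t=1..horizon I. \<bar>d t * (if k = t then mu1 I / d t else 0)\<bar>) = mu1 I"
    if "0 < d k" for d :: "nat \<Rightarrow> real"
  proof -
    have "(\<Sum>t=1..horizon I. \<bar>d t * (if k = t then mu1 I / d t else 0)\<bar>)
        = (\<Sum>t=1..horizon I. if k = t then mu1 I else 0)"
      using that mu1_nonneg by (intro sum.cong) auto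
    then show ?thesis using k by simp
  qed
  show "spike_P I k \<in> demand_set I"
    using Delta_nonneg one [of "delta_P I"] delta_pos [OF k]
    by (intro demand_setI [of _ "\<lambda>t. if k = t then mu1 I / delta_P I t else 0" "Delta_P I"
          "\<lambda>_. 0" "Delta_H I"])
      (auto simp: spike_P_def bias_demand_def)
  show "spike_H I k \<in> demand_set I"
    using Delta_nonneg one [of "delta_H I"] delta_pos [OF k]
    by (intro demand_setI [of _ "\<lambda>_. 0" "Delta_P I"
          "\<lambda>t. if k = t then mu1 I / delta_H I t else 0" "Delta_H I"])
      (auto simp: spike_H_def bias_demand_def)
qed

text \<open>A spike at time \<open>k\<close> changes only one summand of the weight. All other summands are finite, so
they cancel, and the bound on the weight of the arc becomes a bound on this summand.\<close>

lemma spike_stage_le: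
  assumes e: "Trans t x u \<in> arcs G" and k: "k \<in> arc_steps (Trans t x u)"
    and b: "W_bias I (Trans t x u) = ereal b" and s: "W_spike I (Trans t x u) = ereal s"
    and p: "C_power I k (fst (bias_demand I) k - P_MGT I x u) = ereal p"
    and h: "C_heat I k (snd (bias_demand I) k - H_MGT I x u) = ereal h"
  shows "C_power I k (fst (spike_P I k) k - P_MGT I x u) \<le> ereal (p + s)"
    "C_heat I k (snd (spike_H I k) k - H_MGT I x u) \<le> ereal (h + s)"
proof -
  let ?e = "Trans t x u"
  define stage where "stage \<xi> \<tau> =
    C_power I \<tau> (fst \<xi> \<tau> - P_MGT I x u) + C_heat I \<tau> (snd \<xi> \<tau> - H_MGT I x u)" for \<xi> \<tau>
  define rest where "rest = ereal (C_MGT I x u) + (\<Sum>\<tau>\<in>arc_steps ?e - {k}. stage (bias_demand I) \<tau>)"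
  have split: "weight I \<xi> ?e = rest + stage \<xi> k"
    if "\<And>\<tau>. \<tau> \<noteq> k \<Longrightarrow> stage \<xi> \<tau> = stage (bias_demand I) \<tau>" for \<xi>
  proof -
    have "weight I \<xi> ?e = ereal (C_MGT I x u) + (\<Sum>\<tau>\<in>arc_steps ?e. stage \<xi> \<tau>)"
      by (simp add: stage_def)
    also have "(\<Sum>\<tau>\<in>arc_steps ?e. stage \<xi> \<tau>) = stage \<xi> k + (\<Sum>\<tau>\<in>arc_steps ?e - {k}. stage \<xi> \<tau>)"
      using k by (intro sum.remove) auto
    also have "(\<Sum>\<tau>\<in>arc_steps ?e - {k}. stage \<xi> \<tau>)
        = (\<Sum>\<tau>\<in>arc_steps ?e - {k}. stage (bias_demand I) \<tau>)"
      using that by (intro sum.cong) auto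
    finally show ?thesis by (simp add: rest_def ac_simps)
  qed
  have bias: "rest + ereal (p + h) = ereal b"
    using split [of "bias_demand I"] b p h by (simp add: W_bias_def stage_def del: weight.simps)
  then obtain r where r: "rest = ereal r" "r + p + h = b"
    by (cases rest) auto
  have "rest + stage (spike_P I k) k \<le> ereal (b + s)" "rest + stage (spike_H I k) k \<le> ereal (b + s)"
    using le_peak [OF k, of "spike_P I k"] le_peak [OF k, of "spike_H I k"] peak_eq [OF e] b s
    by (simp_all add: split stage_def spike_P_def spike_H_def del: weight.simps)
  moreover have "stage (spike_P I k) k = C_power I k (fst (spike_P I k) k - P_MGT I x u) + ereal h"
    "stage (spike_H I k) k = ereal p + C_heat I k (snd (spike_H I k) k - H_MGT I x u)"
    using p h by (simp_all add: stage_def spike_P_def spike_H_def)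
  ultimately have P: "ereal r + (C_power I k (fst (spike_P I k) k - P_MGT I x u) + ereal h) \<le> ereal (b + s)"
    and H: "ereal r + (ereal p + C_heat I k (snd (spike_H I k) k - H_MGT I x u)) \<le> ereal (b + s)"
    using r(1) by simp_all
  show "C_power I k (fst (spike_P I k) k - P_MGT I x u) \<le> ereal (p + s)"
    using P r(2) by (cases "C_power I k (fst (spike_P I k) k - P_MGT I x u)") simp_all
  show "C_heat I k (snd (spike_H I k) k - H_MGT I x u) \<le> ereal (h + s)"
    using H r(2) by (cases "C_heat I k (snd (spike_H I k) k - H_MGT I x u)") simp_all
qed

text \<open>The bound for a single arc: each share \<open>l\<close> of the budget that falls into the time steps of the
arc costs at most \<open>l\<close> times the spike value of the arc. Demands above the bias are controlled by
convexity, demands below it by monotonicity once the capped demand shows that they are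
feasible.\<close>

lemma weight_le_spread:
  assumes df: "downward_feasible I" and e: "e \<in> arcs G" "is_Trans e" and \<xi>: "\<xi> \<in> demand_set I"
    and b: "W_bias I e = ereal b" and s: "W_spike I e = ereal s"
    and share: "\<And>t. 0 \<le> sP t" "\<And>t. 0 \<le> sH t" "(\<Sum>t=0..horizon I. sP t + sH t) \<le> 1"
    "\<And>t. t \<in> {1..horizon I} \<Longrightarrow> fst \<xi> t \<le> fst (bias_demand I) t + sP t * (mu1 I / delta_P I t)"
    "\<And>t. t \<in> {1..horizon I} \<Longrightarrow> snd \<xi> t \<le> snd (bias_demand I) t + sH t * (mu1 I / delta_H I t)"
  shows "weight I \<xi> e \<le> ereal (b + (\<Sum>t\<in>arc_steps e. sP t + sH t) * s)"
proof -
  obtain t x u where T: "e = Trans t x u" using e(2) by (cases e) auto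
  let ?cap = "(\<lambda>t. min (fst \<xi> t) (fst (bias_demand I) t), \<lambda>t. min (snd \<xi> t) (snd (bias_demand I) t))"
  have "weight I ?cap e < \<infinity>"
    using df [unfolded downward_feasible_def, rule_format, OF e(1) _ capped_demand [OF \<xi>]] b by simp
  then have "weight I ?cap (Trans t x u) \<noteq> \<infinity>"
    unfolding T by (simp del: weight.simps)
  then have cap: "C_power I \<tau> (fst ?cap \<tau> - P_MGT I x u) \<noteq> \<infinity>"
    "C_heat I \<tau> (snd ?cap \<tau> - H_MGT I x u) \<noteq> \<infinity>" if "\<tau> \<in> arc_steps e" for \<tau>
    using weight_finite_iff [of t x u ?cap] e(1) that unfolding T by blast+
  have s0: "0 \<le> s" using W_spike_nonneg [OF e] s by simp
  define p h where "p \<tau> = real_of_ereal (C_power I \<tau> (fst (bias_demand I) \<tau> - P_MGT I x u))"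
    and "h \<tau> = real_of_ereal (C_heat I \<tau> (snd (bias_demand I) \<tau> - H_MGT I x u))" for \<tau>
  have ph: "C_power I \<tau> (fst (bias_demand I) \<tau> - P_MGT I x u) = ereal (p \<tau>)"
    "C_heat I \<tau> (snd (bias_demand I) \<tau> - H_MGT I x u) = ereal (h \<tau>)" if \<tau>: "\<tau> \<in> arc_steps e" for \<tau>
  proof -
    have "C_power I \<tau> (fst (bias_demand I) \<tau> - P_MGT I x u) \<noteq> \<infinity>"
      "C_heat I \<tau> (snd (bias_demand I) \<tau> - H_MGT I x u) \<noteq> \<infinity>"
      using weight_finite_iff [of t x u "bias_demand I"] e(1) b \<tau> unfolding T W_bias_def by auto
    then show "C_power I \<tau> (fst (bias_demand I) \<tau> - P_MGT I x u) = ereal (p \<tau>)"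
      "C_heat I \<tau> (snd (bias_demand I) \<tau> - H_MGT I x u) = ereal (h \<tau>)"
      using arc_utility_costs [OF e(1) \<tau>, THEN utility_cost_not_MInfty] unfolding p_def h_def
      by (intro finite_ereal; blast)+
  qed
  have stage: "C_power I \<tau> (fst \<xi> \<tau> - P_MGT I x u) + C_heat I \<tau> (snd \<xi> \<tau> - H_MGT I x u)
      \<le> ereal (p \<tau> + sP \<tau> * s) + ereal (h \<tau> + sH \<tau> * s)" if \<tau>: "\<tau> \<in> arc_steps e" for \<tau>
  proof (rule add_mono)
    have \<tau>': "\<tau> \<in> {1..horizon I}" using \<tau> arc_steps_subset [OF e(1)] by blast
    have "sP \<tau> + sH \<tau> \<le> (\<Sum>t=0..horizon I. sP t + sH t)"
      using \<tau>' share(1,2) by (intro member_le_sum [of \<tau> _ "\<lambda>t. sP t + sH t"]) auto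
    then have le1: "sP \<tau> \<le> 1" "sH \<tau> \<le> 1"
      using share(1) [of \<tau>] share(2) [of \<tau>] share(3) by linarith+
    note top = spike_stage_le [OF e(1) [unfolded T] \<tau> [unfolded T] b [unfolded T] s [unfolded T] ph [OF \<tau>]]
    show "C_power I \<tau> (fst \<xi> \<tau> - P_MGT I x u) \<le> ereal (p \<tau> + sP \<tau> * s)"
    proof (rule utility_cost_spread [OF arc_utility_costs(1) [OF e(1) \<tau>] ph(1) [OF \<tau>]])
      show "C_power I \<tau> (fst (bias_demand I) \<tau> - P_MGT I x u + mu1 I / delta_P I \<tau>) \<le> ereal (p \<tau> + s)"
        using top(1) by (simp add: spike_P_def algebra_simps)
      show "C_power I \<tau> (fst \<xi> \<tau> - P_MGT I x u) \<noteq> \<infinity>"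
        if "fst \<xi> \<tau> - P_MGT I x u \<le> fst (bias_demand I) \<tau> - P_MGT I x u"
        using cap(1) [OF \<tau>] that by (simp add: min_absorb1)
    qed (use share(1,4) \<tau>' le1 s0 mu1_div_nonneg [OF \<tau>'] in \<open>auto simp: algebra_simps\<close>)
    show "C_heat I \<tau> (snd \<xi> \<tau> - H_MGT I x u) \<le> ereal (h \<tau> + sH \<tau> * s)"
    proof (rule utility_cost_spread [OF arc_utility_costs(2) [OF e(1) \<tau>] ph(2) [OF \<tau>]])
      show "C_heat I \<tau> (snd (bias_demand I) \<tau> - H_MGT I x u + mu1 I / delta_H I \<tau>) \<le> ereal (h \<tau> + s)"
        using top(2) by (simp add: spike_H_def algebra_simps)
      show "C_heat I \<tau> (snd \<xi> \<tau> - H_MGT I x u) \<noteq> \<infinity>"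
        if "snd \<xi> \<tau> - H_MGT I x u \<le> snd (bias_demand I) \<tau> - H_MGT I x u"
        using cap(2) [OF \<tau>] that by (simp add: min_absorb1)
    qed (use share(2,5) \<tau>' le1 s0 mu1_div_nonneg [OF \<tau>'] in \<open>auto simp: algebra_simps\<close>)
  qed
  have "ereal b = ereal (C_MGT I x u) + (\<Sum>\<tau>\<in>arc_steps e. ereal (p \<tau>) + ereal (h \<tau>))"
    using b ph unfolding T W_bias_def by simp
  then have b_eq: "b = C_MGT I x u + (\<Sum>\<tau>\<in>arc_steps e. p \<tau> + h \<tau>)"
    by simp
  have "weight I \<xi> e = ereal (C_MGT I x u) + (\<Sum>\<tau>\<in>arc_steps e.
      C_power I \<tau> (fst \<xi> \<tau> - P_MGT I x u) + C_heat I \<tau> (snd \<xi> \<tau> - H_MGT I x u))"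
    unfolding T by simp
  also have "\<dots> \<le> ereal (C_MGT I x u) +
      (\<Sum>\<tau>\<in>arc_steps e. ereal (p \<tau> + sP \<tau> * s) + ereal (h \<tau> + sH \<tau> * s))"
    by (intro add_mono sum_mono order_refl stage)
  also have "\<dots> = ereal (b + (\<Sum>t\<in>arc_steps e. sP t + sH t) * s)"
    unfolding b_eq by (simp add: sum.distrib flip: sum_distrib_right) (simp add: algebra_simps)
  finally show ?thesis .
qed

section \<open>The worst case of a path\<close>

lemma W_bias_not_MInfty: "e \<in> arcs G \<Longrightarrow> W_bias I e \<noteq> -\<infinity>"
  using weight_not_MInfty by (simp add: W_bias_def)

lemma weight_not_Trans: "\<not> is_Trans e \<Longrightarrow> weight I \<xi> e = 0"
  by (cases e) simp_all

lemma W_spike_le_max_spike: "e \<in> set p \<Longrightarrow> is_Trans e \<Longrightarrow> W_spike I e \<le> max_spike I p"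
  unfolding max_spike_def by (intro Max_ge) auto

lemma max_spike_attained:
  assumes "2 \<le> horizon I" "p \<in> PATH I"
  obtains e where "e \<in> set p" "is_Trans e" "e \<in> arcs G" "W_spike I e = max_spike I p"
proof -
  have "max_spike I p \<in> W_spike I ` {e \<in> set p. is_Trans e}"
    unfolding max_spike_def using PATH_has_Trans [OF assms] by (intro Max_in) auto
  then show ?thesis
    using that PATH_arcs [OF assms(2)] by auto
qed

lemma max_spike_nonneg:
  assumes "2 \<le> horizon I" "p \<in> PATH I"
  shows "0 \<le> max_spike I p"
  using max_spike_attained [OF assms] W_spike_nonneg by metis

text \<open>Every arc costs at most its bias plus the shares in its time steps, times the largest spike on
the path. The shares of the whole path add up to at most one.\<close>

lemma path_cost_le_V_cost:
  assumes df: "downward_feasible I" and T: "2 \<le> horizon I" and p: "p \<in> PATH I"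
    and \<xi>: "\<xi> \<in> demand_set I"
  shows "path_cost I \<xi> p \<le> V_cost I p"
proof (cases "V_cost I p = \<infinity>")
  case False
  obtain sP sH :: "nat \<Rightarrow> real"
    where share: "\<And>t. 0 \<le> sP t" "\<And>t. 0 \<le> sH t" "(\<Sum>t=0..horizon I. sP t + sH t) \<le> 1"
    "\<And>t. t \<in> {1..horizon I} \<Longrightarrow> fst \<xi> t \<le> fst (bias_demand I) t + sP t * (mu1 I / delta_P I t)"
    "\<And>t. t \<in> {1..horizon I} \<Longrightarrow> snd \<xi> t \<le> snd (bias_demand I) t + sH t * (mu1 I / delta_H I t)"
    using demand_shares [OF \<xi>] by blast
  from False have fin: "sum_list (map (W_bias I) p) \<noteq> \<infinity>" "max_spike I p \<noteq> \<infinity>"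
    by (auto simp: V_cost_def)
  obtain M where M: "max_spike I p = ereal M" "0 \<le> M"
    using fin(2) max_spike_nonneg [OF T p] by (cases "max_spike I p") auto
  define b where "b e = real_of_ereal (W_bias I e)" for e
  have b: "W_bias I e = ereal (b e)" if "e \<in> set p" for e
    unfolding b_def using fin(1) that W_bias_not_MInfty PATH_arcs [OF p]
    by (intro finite_ereal) (auto simp: sum_list_PInfty)
  have le: "weight I \<xi> e \<le> ereal (b e + (\<Sum>t\<in>arc_steps e. sP t + sH t) * M)" if e: "e \<in> set p" for e
  proof (cases "is_Trans e")
    case True
    have e': "e \<in> arcs G" using e PATH_arcs [OF p] by blast
    have "W_spike I e \<le> ereal M" "0 \<le> W_spike I e"
      using W_spike_le_max_spike [OF e True] W_spike_nonneg [OF e' True] M by simp_all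
    then obtain s where s: "W_spike I e = ereal s" "s \<le> M"
      by (cases "W_spike I e") auto
    have "weight I \<xi> e \<le> ereal (b e + (\<Sum>t\<in>arc_steps e. sP t + sH t) * s)"
      using weight_le_spread [OF df e' True \<xi> b [OF e] s(1) share] by blast
    also have "(\<Sum>t\<in>arc_steps e. sP t + sH t) * s \<le> (\<Sum>t\<in>arc_steps e. sP t + sH t) * M"
      using s(2) share(1,2) by (intro mult_left_mono sum_nonneg) simp_all
    finally show ?thesis by simp
  next
    case False
    then have "W_bias I e = 0" "arc_steps e = {}"
      using weight_not_Trans [of e] by (auto simp: W_bias_def) (cases e, auto)
    then show ?thesis
      using False weight_not_Trans [of e] b [OF e] by simp
  qed
  have walk: "awalk Source p Terminal" using p by (simp add: PATH_eq)
  have total: "(\<Sum>e\<leftarrow>p. \<Sum>t\<in>arc_steps e. sP t + sH t) \<le> 1"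
    using sum_steps_le [OF walk, of "\<lambda>t. sP t + sH t"] share(1-3) by simp
  have "path_cost I \<xi> p \<le> (\<Sum>e\<leftarrow>p. ereal (b e + (\<Sum>t\<in>arc_steps e. sP t + sH t) * M))"
    unfolding path_cost_def by (intro sum_list_mono le)
  also have "\<dots> = ereal ((\<Sum>e\<leftarrow>p. b e) + (\<Sum>e\<leftarrow>p. \<Sum>t\<in>arc_steps e. sP t + sH t) * M)"
    by (simp add: sum_list_addf sum_list_mult_const)
  also have "\<dots> \<le> ereal ((\<Sum>e\<leftarrow>p. b e) + M)"
    using mult_right_mono [OF total M(2)] by simp
  also have "\<dots> = V_cost I p"
  proof -
    have "map (W_bias I) p = map (\<lambda>e. ereal (b e)) p"
      using b by (intro map_cong) auto
    then have "sum_list (map (W_bias I) p) = ereal (\<Sum>e\<leftarrow>p. b e)"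
      by (simp only: sum_list_ereal)
    then show ?thesis by (simp add: V_cost_def M)
  qed
  finally show ?thesis .
qed simp

text \<open>If the bias length is infinite, the bias demand is a worst case. Otherwise the worst case is the
spike that attains the largest \<^const>\<open>W_spike\<close> on the path: the arc that it hits pays bias plus
spike, and all others pay at least their bias.\<close>

lemma V_cost_reached:
  assumes T: "2 \<le> horizon I" and p: "p \<in> PATH I"
  shows "\<exists>\<xi>\<in>demand_set I. V_cost I p \<le> path_cost I \<xi> p"
proof (cases "sum_list (map (W_bias I) p) = \<infinity>")
  case True
  then have "path_cost I (bias_demand I) p = \<infinity>"
    by (simp add: path_cost_def W_bias_def [abs_def])
  then show ?thesis
    using bias_in_demand_set by (intro bexI) auto
next
  case False
  then have fin: "W_bias I e \<noteq> \<infinity>" if "e \<in> set p" for e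
    using that by (auto simp: sum_list_PInfty)
  obtain e where e: "e \<in> set p" "is_Trans e" "e \<in> arcs G" "W_spike I e = max_spike I p"
    using max_spike_attained [OF T p] .
  obtain k \<xi> where k: "k \<in> arc_steps e" "\<xi> \<in> {spike_P I k, spike_H I k}"
    and eq: "weight I \<xi> e = W_bias I e + W_spike I e"
    using spike_attained [OF e(3,2)] .
  have k': "k \<in> {1..horizon I}" using k(1) arc_steps_subset [OF e(3)] by blast
  have ge: "W_bias I a \<le> weight I \<xi> a" if "a \<in> set p" for a
    using W_bias_le_weight [OF PATH_arcs [OF p that] fin [OF that], of \<xi>] spike_ge_bias [OF k'] k(2)
    by auto
  obtain xs ys where split: "p = xs @ e # ys"
    using e(1) by (auto simp: in_set_conv_decomp)
  have "V_cost I p = sum_list (map (W_bias I) xs) + (weight I \<xi> e + sum_list (map (W_bias I) ys))"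
    by (simp add: V_cost_def split eq e(4) [symmetric, unfolded split] ac_simps)
  also have "\<dots> \<le> sum_list (map (weight I \<xi>) xs) + (weight I \<xi> e + sum_list (map (weight I \<xi>) ys))"
    using ge by (intro add_mono sum_list_mono order_refl) (auto simp: split)
  also have "\<dots> = path_cost I \<xi> p"
    by (simp add: path_cost_def split)
  finally show ?thesis
    using k(2) spikes_in_demand_set [OF k'] by auto
qed

lemma robust_cost_eq_V_cost:
  assumes "downward_feasible I" "2 \<le> horizon I" "p \<in> PATH I"
  shows "robust_cost I p = V_cost I p"
proof (rule antisym)
  show "robust_cost I p \<le> V_cost I p"
    unfolding robust_cost_def by (intro SUP_least path_cost_le_V_cost assms)
  obtain \<xi> where "\<xi> \<in> demand_set I" "V_cost I p \<le> path_cost I \<xi> p"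
    using V_cost_reached [OF assms(2,3)] by blast
  then show "V_cost I p \<le> robust_cost I p"
    unfolding robust_cost_def by (rule SUP_upper2)
qed

text \<open>With a horizon of one time step there is no transition, hence no \<^const>\<open>max_spike\<close>, and all
demands cost nothing.\<close>

lemma worst_case_attained:
  assumes df: "downward_feasible I" and p: "p \<in> PATH I"
  shows "\<exists>\<xi>\<in>demand_set I. path_cost I \<xi> p = robust_cost I p"
proof (cases "2 \<le> horizon I")
  case True
  obtain \<xi> where \<xi>: "\<xi> \<in> demand_set I" "V_cost I p \<le> path_cost I \<xi> p"
    using V_cost_reached [OF True p] by blast
  then show ?thesis
    using path_cost_le_V_cost [OF df True p \<xi>(1)] robust_cost_eq_V_cost [OF df True p]
    by (intro bexI [of _ \<xi>]) auto
next
  case False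
  have "weight I \<xi> e = 0" if "e \<in> set p" for \<xi> e
    using False Trans_imp_horizon PATH_arcs [OF p that] weight_not_Trans by blast
  then have zero: "path_cost I \<xi> p = 0" for \<xi>
    by (simp add: path_cost_def cong: map_cong)
  have "demand_set I \<noteq> {}" using bias_in_demand_set by blast
  then show ?thesis
    using zero bias_in_demand_set by (auto simp: robust_cost_def)
qed

section \<open>Thresholds find the best trade-off of length against spike\<close>

lemma threshold_sum_finite:
  assumes fin: "sum_list (map (threshold_weight I \<alpha>) p) \<noteq> \<infinity>"
  shows "sum_list (map (threshold_weight I \<alpha>) p) = sum_list (map (W_bias I) p)"
    and "e \<in> set p \<Longrightarrow> is_Trans e \<Longrightarrow> W_spike I e \<le> \<alpha>"
proof -
  have fin': "threshold_weight I \<alpha> e \<noteq> \<infinity>" if "e \<in> set p" for e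
    using fin that by (auto simp: sum_list_PInfty)
  have "threshold_weight I \<alpha> e = W_bias I e" if "e \<in> set p" for e
    using fin' [OF that] by (auto simp: threshold_weight_def split: if_splits)
  then show "sum_list (map (threshold_weight I \<alpha>) p) = sum_list (map (W_bias I) p)"
    by (simp cong: map_cong)
  show "W_spike I e \<le> \<alpha>" if "e \<in> set p" "is_Trans e"
    using fin' [OF that(1)] that(2) by (auto simp: threshold_weight_def split: if_splits)
qed

lemma threshold_sum_max_spike:
  "sum_list (map (threshold_weight I (max_spike I p)) p) = sum_list (map (W_bias I) p)"
proof -
  have "threshold_weight I (max_spike I p) e = W_bias I e" if "e \<in> set p" for e
    using W_spike_le_max_spike [OF that] by (auto simp: threshold_weight_def)
  then show ?thesis by (simp cong: map_cong)
qed

text \<open>The threshold \<^term>\<open>max_spike I p'\<close> removes no arc of \<open>p'\<close>, so a shortest path \<open>q\<close> is at most as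
long as \<open>p'\<close>. If that length is finite, then no arc of \<open>q\<close> was removed either, which bounds its
spike.\<close>

lemma shortest_path_max_spike_optimal:
  assumes T: "2 \<le> horizon I" and p': "p' \<in> PATH I" and q: "shortest_path I (max_spike I p') q"
  shows "V_cost I q \<le> V_cost I p'"
proof (cases "sum_list (map (W_bias I) p') = \<infinity>")
  case True
  then show ?thesis
    using max_spike_nonneg [OF T p'] by (simp add: V_cost_def)
next
  case False
  let ?c = "\<lambda>p. sum_list (map (threshold_weight I (max_spike I p')) p)"
  have q_path: "q \<in> PATH I" using q by (simp add: shortest_path_def)
  have le: "?c q \<le> ?c p'"
    using q p' by (auto simp: shortest_path_def Let_def)
  then have fin: "?c q \<noteq> \<infinity>"
    using False threshold_sum_max_spike [of p'] by auto
  obtain e where "e \<in> set q" "is_Trans e" "W_spike I e = max_spike I q"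
    using max_spike_attained [OF T q_path] by metis
  then have "max_spike I q \<le> max_spike I p'"
    using threshold_sum_finite(2) [OF fin] by metis
  then show ?thesis
    unfolding V_cost_def
    using le threshold_sum_finite(1) [OF fin] threshold_sum_max_spike [of p'] by (intro add_mono) auto
qed

lemma max_spike_in_Thresh:
  assumes "2 \<le> horizon I" "p \<in> PATH I"
  shows "max_spike I p \<in> Thresh I"
proof -
  obtain e where "is_Trans e" "e \<in> arcs G" "W_spike I e = max_spike I p"
    using max_spike_attained [OF assms] .
  then show ?thesis unfolding Thresh_def by (metis (mono_tags, lifting) imageI mem_Collect_eq)
qed

text \<open>The maximal spike of any competitor \<open>p'\<close> is one of the thresholds that the algorithm tries.\<close>

lemma algorithm_A_optimal:
  assumes "algorithm_A I v p"
  shows "2 \<le> horizon I" "p \<in> PATH I" "v = V_cost I p"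
    and "p' \<in> PATH I \<Longrightarrow> V_cost I p \<le> V_cost I p'"
proof -
  obtain V_path \<gamma> where
    sp: "\<And>\<alpha>. \<alpha> \<in> Thresh I \<Longrightarrow> shortest_path I \<alpha> (V_path \<alpha>)"
    and \<gamma>: "\<gamma> \<in> Thresh I" "\<And>\<beta>. \<beta> \<in> Thresh I \<Longrightarrow> V_cost I (V_path \<gamma>) \<le> V_cost I (V_path \<beta>)"
    and p: "v = V_cost I (V_path \<gamma>)" "p = V_path \<gamma>"
    using assms unfolding algorithm_A_def by blast
  show T: "2 \<le> horizon I"
    using \<gamma>(1) Trans_imp_horizon by (auto simp: Thresh_def)
  show "p \<in> PATH I" "v = V_cost I p"
    using sp [OF \<gamma>(1)] p by (auto simp: shortest_path_def)
  show "V_cost I p \<le> V_cost I p'" if "p' \<in> PATH I"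
    using \<gamma>(2) [OF max_spike_in_Thresh [OF T that]]
      shortest_path_max_spike_optimal [OF T that sp [OF max_spike_in_Thresh [OF T that]]] p(2)
    by simp
qed

text \<open>A lexicographic minimum over the finite set of paths: among the shortest paths, one with the
least maximal spike.\<close>

lemma shortest_path_exists:
  assumes "PATH I \<noteq> {}"
  shows "\<exists>p. shortest_path I \<alpha> p"
proof -
  let ?c = "\<lambda>p. sum_list (map (threshold_weight I \<alpha>) p)"
  define S where "S = {p \<in> PATH I. \<forall>p'\<in>PATH I. ?c p \<le> ?c p'}"
  have "arg_min_on ?c (PATH I) \<in> S"
    using arg_min_if_finite(1) [OF finite_PATH assms, of ?c]
      arg_min_least [OF finite_PATH assms, of _ ?c] by (auto simp: S_def)
  then have S: "finite S" "S \<noteq> {}"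
    using finite_PATH by (auto simp: S_def)
  define p where "p = arg_min_on (max_spike I) S"
  have p: "p \<in> S" "\<And>q. q \<in> S \<Longrightarrow> max_spike I p \<le> max_spike I q"
    unfolding p_def using arg_min_if_finite(1) [OF S] arg_min_least [OF S] by auto
  have "?c p < ?c p' \<or> ?c p = ?c p' \<and> max_spike I p \<le> max_spike I p'" if p': "p' \<in> PATH I" for p'
  proof (cases "?c p < ?c p'")
    case False
    then have eq: "?c p = ?c p'" using p(1) p' by (auto simp: S_def intro: antisym)
    then have "p' \<in> S" using p(1) p' by (auto simp: S_def)
    then show ?thesis using p(2) eq by blast
  qed simp
  then show ?thesis
    using p(1) by (intro exI [of _ p]) (auto simp: shortest_path_def Let_def S_def)
qed

lemma algorithm_A_exists:
  assumes T: "2 \<le> horizon I" and ne: "PATH I \<noteq> {}"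
  shows "\<exists>v p. algorithm_A I v p"
proof -
  obtain V_path where sp: "\<And>\<alpha>. shortest_path I \<alpha> (V_path \<alpha>)"
    using shortest_path_exists [OF ne] by metis
  have fin: "finite (Thresh I)" unfolding Thresh_def by simp
  obtain p0 where "p0 \<in> PATH I" using ne by blast
  then have "Thresh I \<noteq> {}" using max_spike_in_Thresh [OF T] by blast
  then have "arg_min_on (\<lambda>\<beta>. V_cost I (V_path \<beta>)) (Thresh I) \<in> Thresh I"
    "\<And>\<beta>. \<beta> \<in> Thresh I \<Longrightarrow>
      V_cost I (V_path (arg_min_on (\<lambda>\<beta>. V_cost I (V_path \<beta>)) (Thresh I))) \<le> V_cost I (V_path \<beta>)"
    using arg_min_if_finite(1) [OF fin] arg_min_least [OF fin, of _ "\<lambda>\<beta>. V_cost I (V_path \<beta>)"] by auto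
  then show ?thesis
    unfolding algorithm_A_def using sp by blast
qed

lemma algorithm_A_robust:
  assumes df: "downward_feasible I" and A: "algorithm_A I v p"
  shows "robust_solution I v p"
  unfolding robust_solution_def
  using algorithm_A_optimal [OF A] robust_cost_eq_V_cost [OF df] by metis

end

section \<open>Computations with a step count\<close>

lemma result_bind [simp]: "result (bind_timed m k) = result (k (result m))"
  and steps_bind [simp]: "steps (bind_timed m k) = steps m + steps (k (result m))"
  by (simp_all add: bind_timed_def split: timed.split)

lemma result_step [simp]: "result (step a) = a"
  and steps_step [simp]: "steps (step a) = 1"
  by (simp_all add: step_def)

lemma result_foldT: "result (foldT g b xs) = fold (\<lambda>a b. result (g b a)) xs b"
  by (induction xs arbitrary: b) simp_all

lemma steps_foldT_le:
  assumes "\<And>b a. a \<in> set xs \<Longrightarrow> steps (g b a) \<le> c"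
  shows "steps (foldT g b xs) \<le> (c + 1) * length xs + 1"
  using assms
proof (induction xs arbitrary: b)
  case (Cons a xs)
  have "steps (g b a) \<le> c" using Cons.prems by simp
  moreover have "steps (foldT g (result (g b a)) xs) \<le> (c + 1) * length xs + 1"
    using Cons by simp
  ultimately show ?case by simp
qed simp

lemma fold_add: "fold (\<lambda>a s. s + f a) xs c = c + (\<Sum>a\<leftarrow>xs. f a :: 'a :: comm_monoid_add)"
  by (induction xs arbitrary: c) (simp_all add: ac_simps)

lemma fold_max: "fold (\<lambda>a m. max m (f a)) xs c = Max (insert c (f ` set xs))"
  for c :: "'a :: linorder"
proof (induction xs arbitrary: c)
  case (Cons a xs)
  show ?case
  proof (cases "xs = []")
    case False
    then show ?thesis
      using Cons.IH [of "max c (f a)"] by (simp add: max.assoc)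
  qed (simp add: Cons.IH)
qed simp

lemma result_weightT: "result (weightT I \<xi> e) = weight I \<xi> e"
  by (cases e) (simp_all add: weightT_def result_foldT fold_add interv_sum_list_conv_sum_set_nat)

context valid_instance
begin

section \<open>Annotating and sorting the arcs\<close>

text \<open>The spike value as the implementation stores it: the value minus infinity at the source and the
terminal is neutral for maxima and passes all thresholds.\<close>

definition spike :: "('x, 'u) arc \<Rightarrow> ereal" where
  "spike e = (if is_Trans e then W_spike I e else -\<infinity>)"

definition annotate :: "('x, 'u) arc \<Rightarrow> ('x, 'u) warc" where
  "annotate e = (e, W_bias I e, spike e)"

lemma result_spikeT:
  assumes "e \<in> arcs G"
  shows "result (spikeT I (W_bias I e) e) = spike e"
proof (cases e)
  case (Trans t x u)
  let ?f = "\<lambda>k. max (weight I (spike_P I k) e) (weight I (spike_H I k) e)"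
  have "arc_steps e \<noteq> {}" using arc_steps_nonempty [OF assms] Trans by simp
  then have "Max (insert (-\<infinity>) (?f ` arc_steps e)) = peak e"
    unfolding peak_def using arc_steps_finite by (subst Max_insert) auto
  then show ?thesis
    using Trans by (simp add: spikeT_def result_foldT result_weightT fold_max spike_def W_spike_eq
        del: weight.simps)
qed (simp_all add: spikeT_def spike_def)

lemma result_annotateT:
  assumes "set es \<subseteq> arcs G"
  shows "result (annotateT I es) = rev (map annotate es)"
proof -
  have "fold (\<lambda>e as. (e, W_bias I e, result (spikeT I (W_bias I e) e)) # as) es as = rev (map annotate es) @ as" for as
    using assms by (induction es arbitrary: as) (simp_all add: result_spikeT annotate_def)
  then show ?thesis
    by (simp add: annotateT_def result_foldT result_weightT W_bias_def)
qed

lemma result_insertT: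
  "set (result (insertT I a bs)) = insert a (set bs)"
  "length (result (insertT I a bs)) = Suc (length bs)"
  "sorted (map (arc_time I \<circ> fst) bs) \<Longrightarrow> sorted (map (arc_time I \<circ> fst) (result (insertT I a bs)))"
proof -
  show set: "set (result (insertT I a bs)) = insert a (set bs)" for bs
    by (induction bs) auto
  show "length (result (insertT I a bs)) = Suc (length bs)"
    by (induction bs) auto
  show "sorted (map (arc_time I \<circ> fst) bs) \<Longrightarrow> sorted (map (arc_time I \<circ> fst) (result (insertT I a bs)))"
  proof (induction bs)
    case (Cons b bs)
    then show ?case by (auto simp: set)
  qed simp
qed

lemma steps_insertT: "steps (insertT I a bs) \<le> length bs + 1"
  by (induction bs) auto

lemma result_sortT:
  "set (result (sortT I as)) = set as"
  "length (result (sortT I as)) = length as"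
  "sorted (map (arc_time I \<circ> fst) (result (sortT I as)))"
proof -
  let ?f = "\<lambda>as bs. fold (\<lambda>a bs. result (insertT I a bs)) as bs"
  have "set (?f as bs) = set as \<union> set bs \<and> length (?f as bs) = length as + length bs \<and>
      (sorted (map (arc_time I \<circ> fst) bs) \<longrightarrow> sorted (map (arc_time I \<circ> fst) (?f as bs)))" for bs
    by (induction as arbitrary: bs) (auto simp: result_insertT)
  from this [of "[]"] show "set (result (sortT I as)) = set as"
    "length (result (sortT I as)) = length as"
    "sorted (map (arc_time I \<circ> fst) (result (sortT I as)))"
    by (simp_all add: sortT_def result_foldT)
qed

lemma steps_sortT: "steps (sortT I as) \<le> length as * (length as + 2) + 1"
proof -
  have "steps (foldT (\<lambda>bs a. insertT I a bs) bs as) \<le> length as * (length bs + length as + 2) + 1" for bs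
  proof (induction as arbitrary: bs)
    case (Cons a as)
    have "steps (foldT (\<lambda>bs a. insertT I a bs) bs (a # as))
        \<le> (length bs + 1) + (length as * (Suc (length bs) + length as + 2) + 1) + 1"
      using steps_insertT [of a bs] Cons.IH [of "result (insertT I a bs)"]
      by (simp add: result_insertT(2))
    also have "\<dots> \<le> length (a # as) * (length bs + length (a # as) + 2) + 1"
      by (simp add: algebra_simps)
    finally show ?case .
  qed simp
  from this [of "[]"] show ?thesis by (simp add: sortT_def)
qed

section \<open>Scanning the arcs in topological order\<close>

definition walk_length :: "(ereal \<Rightarrow> ereal \<Rightarrow> ereal) \<Rightarrow> ('x, 'u) arc list \<Rightarrow> ereal" where
  "walk_length \<omega> p = (\<Sum>e\<leftarrow>p. \<omega> (W_bias I e) (spike e))"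

text \<open>Unlike \<^const>\<open>max_spike\<close>, this is meaningful for walks without transitions, such as the empty
walk with which a scan begins.\<close>

definition walk_spike :: "('x, 'u) arc list \<Rightarrow> ereal" where
  "walk_spike p = Max (insert (-\<infinity>) (spike ` set p))"

lemma walk_spike_Nil [simp]: "walk_spike [] = -\<infinity>"
  by (simp add: walk_spike_def)

lemma walk_spike_snoc [simp]: "walk_spike (p @ [e]) = max (walk_spike p) (spike e)"
proof -
  have "walk_spike (p @ [e]) = Max (insert (spike e) (insert (-\<infinity>) (spike ` set p)))"
    by (simp add: walk_spike_def insert_commute)
  also have "\<dots> = max (spike e) (walk_spike p)"
    unfolding walk_spike_def by (intro Max_insert) simp_all
  finally show ?thesis by (simp add: max.commute)
qed

definition represents ::
  "(ereal \<Rightarrow> ereal \<Rightarrow> ereal) \<Rightarrow> 'x vertex \<Rightarrow> ('x, 'u) label \<Rightarrow> ('x, 'u) arc list \<Rightarrow> bool" where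
  "represents \<omega> v l p \<longleftrightarrow>
     awalk Source p v \<and> l = (walk_length \<omega> p, walk_spike p, rev (map annotate p))"

text \<open>A label dominates a walk if it is lexicographically at least as good, except that the spikes are
not compared at infinite length. The exception is needed for the relation to survive the
extension of label and walk by an arc (\<open>dominates_snoc\<close>): an infinite weight turns a strictly
shorter label into one of equal, infinite length, whose spike may be larger.\<close>

definition dominates ::
  "(ereal \<Rightarrow> ereal \<Rightarrow> ereal) \<Rightarrow> ('x, 'u) label \<Rightarrow> ('x, 'u) arc list \<Rightarrow> bool" where
  "dominates \<omega> l p \<longleftrightarrow> (case l of (d, m, _) \<Rightarrow>
     d \<le> walk_length \<omega> p \<and> (d = walk_length \<omega> p \<and> d \<noteq> \<infinity> \<longrightarrow> m \<le> walk_spike p))"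

lemma dominates_better:
  assumes "dominates \<omega> l p" "\<not> better_label l l'"
  shows "dominates \<omega> l' p"
  using assms by (cases l; cases l') (auto simp: dominates_def better_label_def)

text \<open>If the extended lengths agree and are finite, then the appended weight is finite and cancels, so
the lengths agreed before.\<close>

lemma dominates_snoc:
  assumes "dominates \<omega> (d, m, q) p" "\<omega> (W_bias I e) (spike e) \<noteq> -\<infinity>"
  shows "dominates \<omega> (d + \<omega> (W_bias I e) (spike e), max m (spike e), q') (p @ [e])"
proof -
  let ?w = "\<omega> (W_bias I e) (spike e)"
  have le: "d \<le> walk_length \<omega> p"
    and eq: "d = walk_length \<omega> p \<Longrightarrow> d \<noteq> \<infinity> \<Longrightarrow> m \<le> walk_spike p"
    using assms(1) by (auto simp: dominates_def)
  have "m \<le> walk_spike p" if "d + ?w = walk_length \<omega> p + ?w" "d + ?w \<noteq> \<infinity>"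
  proof (rule eq)
    show "d = walk_length \<omega> p" "d \<noteq> \<infinity>"
      using that assms(2) by (cases d; cases "walk_length \<omega> p"; cases ?w; simp)+
  qed
  moreover have "walk_length \<omega> (p @ [e]) = walk_length \<omega> p + ?w"
    by (simp add: walk_length_def)
  moreover have "max m (spike e) \<le> max (walk_spike p) (spike e)" if "m \<le> walk_spike p"
    using that by (intro max.mono order_refl)
  ultimately show ?thesis
    using add_right_mono [OF le, of ?w] unfolding dominates_def prod.case walk_spike_snoc by metis
qed

definition end_points :: "'x vertex set" where
  "end_points = {Source, Terminal} \<union> arc_tail I ` arcs G \<union> arc_head I ` arcs G"

text \<open>The invariant of a scan that has processed the arcs in \<open>S\<close>: each label belongs to some walk from
the source, and each walk with arcs in \<open>S\<close> is dominated by the label of its end. The first part is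
restricted to the end points of arcs, the source and the terminal, because no other entry of the
array is initialised.\<close>

definition labels_correct ::
  "(ereal \<Rightarrow> ereal \<Rightarrow> ereal) \<Rightarrow> ('x, 'u) labelling \<Rightarrow> ('x, 'u) arc set \<Rightarrow> bool" where
  "labels_correct \<omega> lab S \<longleftrightarrow>
     (\<forall>v\<in>end_points. \<forall>l. lab v = Some l \<longrightarrow> (\<exists>p. represents \<omega> v l p)) \<and>
     (\<forall>v p. awalk Source p v \<and> set p \<subseteq> S \<longrightarrow> (\<exists>l. lab v = Some l \<and> dominates \<omega> l p))"

text \<open>Since the arcs are processed in the order of the times of their tails, nothing processed so far
can follow the new arc on a walk: it would have to start at a strictly later time.\<close>

lemma new_walk_ends_with_new_arc:
  assumes walk: "awalk Source p v" "set p \<subseteq> insert e S"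
    and late: "\<forall>f\<in>S. arc_time I f \<le> arc_time I e"
  obtains "set p \<subseteq> S"
  | p' where "p = p' @ [e]" "set p' \<subseteq> S" "awalk Source p' (arc_tail I e)" "v = arc_head I e"
proof (cases "e \<in> set p")
  case False
  then show ?thesis using that(1) walk(2) by blast
next
  case True
  then obtain xs ys where p: "p = xs @ e # ys" "e \<notin> set xs"
    by (auto dest: split_list_first)
  then have w: "awalk Source xs (arc_tail I e)" "awalk (arc_head I e) ys v" "e \<in> arcs G"
    using walk(1) by (auto simp: awalk_Cons_iff)
  have "arc_time I e < arc_time I f" if "f \<in> set ys" for f
    using awalk_times(2) [OF w(2) that] arc_time_less_head [OF w(3)] by simp
  moreover have "arc_time I f \<le> arc_time I e" if "f \<in> set ys" for f
    using that walk(2) late p(1) by auto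
  ultimately have "ys = []" by (cases ys) (auto simp: not_le [symmetric])
  then show ?thesis
    using that(2) [of xs] p w walk(2) by (auto simp: awalk_Nil_iff)
qed

text \<open>The only new walks are old walks to the tail of the arc followed by the arc, and these are
dominated by the extended label of the tail. The label at the head is replaced only by a better
one, so it keeps dominating the old walks.\<close>

lemma relaxT_correct:
  assumes lab: "labels_correct \<omega> lab S" and e: "e \<in> arcs G"
    and late: "\<forall>f\<in>S. arc_time I f \<le> arc_time I e"
    and \<omega>: "\<omega> (W_bias I e) (spike e) \<noteq> -\<infinity>"
  shows "labels_correct \<omega> (result (relaxT I \<omega> lab (annotate e))) (insert e S)"
proof -
  let ?u = "arc_tail I e" and ?v = "arc_head I e" and ?lab' = "result (relaxT I \<omega> lab (annotate e))"
  have sound: "\<exists>p. represents \<omega> v l p" if "v \<in> end_points" "lab v = Some l" for v l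
    using lab that unfolding labels_correct_def by blast
  have old: "\<exists>l. lab v = Some l \<and> dominates \<omega> l p" if "awalk Source p v" "set p \<subseteq> S" for v p
    using lab that unfolding labels_correct_def by blast
  have ends: "?u \<in> end_points" "?v \<in> end_points" using e by (auto simp: end_points_def)
  show ?thesis
  proof (cases "lab ?u")
    case None
    then have "?lab' = lab" by (simp add: relaxT_def annotate_def)
    moreover have "\<exists>l. lab v = Some l \<and> dominates \<omega> l p"
      if walk: "awalk Source p v" "set p \<subseteq> insert e S" for v p
      using walk late
    proof (cases rule: new_walk_ends_with_new_arc)
      case 1
      then show ?thesis using old walk(1) by blast
    next
      case (2 p')
      then show ?thesis using old [of p' ?u] None by simp
    qed
    ultimately show ?thesis
      unfolding labels_correct_def using sound by auto
  next
    case (Some l0)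
    obtain d m q where l0: "l0 = (d, m, q)" by (cases l0)
    define l where "l = (d + \<omega> (W_bias I e) (spike e), max m (spike e), annotate e # q)"
    define l' where "l' = (case lab ?v of None \<Rightarrow> l | Some k \<Rightarrow> if better_label l k then l else k)"
    have lab': "?lab' = lab(?v := Some l')"
      using Some by (auto simp: relaxT_def annotate_def l0 l_def l'_def Let_def split: option.split)
    obtain p0 where p0: "represents \<omega> ?u (d, m, q) p0"
      using sound [OF ends(1) Some] l0 by blast
    then have "represents \<omega> ?v l (p0 @ [e])"
      using awalk_appendI [of Source p0 ?u "[e]" ?v] arc_implies_awalk [OF e]
      by (auto simp: represents_def l_def walk_length_def)
    then have "\<exists>p. represents \<omega> ?v l' p"
      using sound [OF ends(2)] by (auto simp: l'_def split: option.split)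
    moreover have not_better: "\<not> better_label l l'" "lab ?v = Some k \<Longrightarrow> \<not> better_label k l'" for k
      by (auto simp: l'_def better_label_def split: option.splits)
    have "\<exists>l. ?lab' v = Some l \<and> dominates \<omega> l p"
      if walk: "awalk Source p v" "set p \<subseteq> insert e S" for v p
      using walk late
    proof (cases rule: new_walk_ends_with_new_arc)
      case 1
      then obtain k where k: "lab v = Some k" "dominates \<omega> k p" using old walk(1) by blast
      then show ?thesis
        using dominates_better [OF k(2) not_better(2)] by (auto simp: lab' simp del: split_paired_Ex)
    next
      case (2 p')
      then have "dominates \<omega> (d, m, q) p'" using old [of p' ?u] Some l0 by auto
      then have "dominates \<omega> l (p' @ [e])"
        unfolding l_def using \<omega> by (rule dominates_snoc)
      then have "dominates \<omega> l' p"
        using dominates_better not_better(1) 2(1) by blast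
      then show ?thesis using 2(4) by (simp add: lab')
    qed
    ultimately show ?thesis
      unfolding labels_correct_def using sound by (auto simp: lab')
  qed
qed

lemma fold_relaxT_correct:
  assumes "labels_correct \<omega> lab S" "set fs \<subseteq> arcs G" "sorted (map (arc_time I) fs)"
    and "\<forall>f\<in>S. \<forall>e\<in>set fs. arc_time I f \<le> arc_time I e"
    and "\<And>e. e \<in> arcs G \<Longrightarrow> \<omega> (W_bias I e) (spike e) \<noteq> -\<infinity>"
  shows "labels_correct \<omega> (fold (\<lambda>a lab. result (relaxT I \<omega> lab a)) (map annotate fs) lab) (S \<union> set fs)"
  using assms
proof (induction fs arbitrary: lab S)
  case (Cons e fs)
  have "labels_correct \<omega> (result (relaxT I \<omega> lab (annotate e))) (insert e S)"
    using Cons.prems by (intro relaxT_correct) auto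
  then have "labels_correct \<omega> (fold (\<lambda>a lab. result (relaxT I \<omega> lab a)) (map annotate fs)
      (result (relaxT I \<omega> lab (annotate e)))) (insert e S \<union> set fs)"
    using Cons.prems by (intro Cons.IH) auto
  then show ?case by simp
qed simp

lemma walk_spike_eq_max_spike:
  assumes "2 \<le> horizon I" "p \<in> PATH I"
  shows "walk_spike p = max_spike I p"
proof -
  let ?S = "{e \<in> set p. is_Trans e}"
  have "insert (-\<infinity>) (spike ` set p) = insert (-\<infinity>) (W_spike I ` ?S)"
    by (auto simp: spike_def)
  moreover have "Max (insert (-\<infinity>) (W_spike I ` ?S)) = max (-\<infinity>) (Max (W_spike I ` ?S))"
    using PATH_has_Trans [OF assms] by (intro Max_insert) auto
  ultimately show ?thesis
    by (simp add: walk_spike_def max_spike_def)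
qed

lemma result_scanT:
  assumes fs: "set fs = arcs G" "sorted (map (arc_time I) fs)"
    and \<omega>: "\<And>e. e \<in> arcs G \<Longrightarrow> \<omega> (W_bias I e) (spike e) \<noteq> -\<infinity>"
  shows "case result (scanT I \<omega> (map annotate fs)) of
      None \<Rightarrow> PATH I = {}
    | Some l \<Rightarrow> (\<exists>p\<in>PATH I. represents \<omega> Terminal l p) \<and> (\<forall>p\<in>PATH I. dominates \<omega> l p)"
proof -
  define lab where "lab = fold (\<lambda>(e, b, s) lab. lab(arc_tail I e := None, arc_head I e := None))
    (map annotate fs) (\<lambda>_. undefined :: ('x, 'u) label option)"
  define lab' where "lab' = lab(Source := Some (0, -\<infinity>, []), Terminal := None)"
  define lab'' where "lab'' = fold (\<lambda>a lab. result (relaxT I \<omega> lab a)) (map annotate fs) lab'"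
  have res: "result (scanT I \<omega> (map annotate fs)) = lab'' Terminal"
    by (simp add: scanT_def result_foldT lab''_def lab'_def lab_def case_prod_unfold)
  have init: "fold (\<lambda>(e, b, s) lab. lab(arc_tail I e := None, arc_head I e := None)) (map annotate es) l v = None"
    if "v \<in> arc_tail I ` set es \<union> arc_head I ` set es \<or> l v = None"
    for es v and l :: "('x, 'u) labelling"
    using that by (induction es arbitrary: l) (auto simp: annotate_def)
  then have "lab v = None" if "v \<in> arc_tail I ` arcs G \<union> arc_head I ` arcs G" for v
    unfolding lab_def using that fs(1) by (intro init) auto
  then have none: "lab' v = None" if "v \<in> end_points" "v \<noteq> Source" for v
    using that by (auto simp: lab'_def end_points_def)
  have source: "lab' Source = Some (0, -\<infinity>, [])"
    by (simp add: lab'_def)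
  have "labels_correct \<omega> lab' {}"
    unfolding labels_correct_def
  proof (intro conjI ballI allI impI)
    fix v l assume "v \<in> end_points" "lab' v = Some l"
    moreover from this have "v = Source" using none [of v] by (cases "v = Source") auto
    ultimately have "v = Source" "l = (0, -\<infinity>, [])" using source by auto
    then have "represents \<omega> v l []"
      by (simp add: represents_def walk_length_def awalk_Nil_iff)
    then show "\<exists>p. represents \<omega> v l p" ..
  next
    fix v p assume "awalk Source p v \<and> set p \<subseteq> {}"
    then have "p = []" "v = Source" by (auto simp: awalk_Nil_iff)
    then show "\<exists>l. lab' v = Some l \<and> dominates \<omega> l p"
      using source by (simp add: dominates_def walk_length_def)
  qed
  then have "labels_correct \<omega> lab'' ({} \<union> set fs)"
    unfolding lab''_def using fs \<omega> by (intro fold_relaxT_correct) auto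
  then have correct: "labels_correct \<omega> lab'' (arcs G)"
    using fs(1) by simp
  have dom: "\<exists>l. lab'' Terminal = Some l \<and> dominates \<omega> l p" if "p \<in> PATH I" for p
    using correct that unfolding labels_correct_def PATH_eq by (auto simp: awalk_def)
  show ?thesis
  proof (cases "lab'' Terminal")
    case None
    then show ?thesis using dom res by auto
  next
    case (Some l)
    have "\<exists>p. represents \<omega> Terminal l p"
      using correct Some unfolding labels_correct_def end_points_def by blast
    then have "\<exists>p\<in>PATH I. represents \<omega> Terminal l p"
      by (auto simp: PATH_eq represents_def)
    then show ?thesis using dom res Some by auto
  qed
qed

section \<open>Shortest paths and the minimisation over the thresholds\<close>

definition threshold :: "ereal \<Rightarrow> ereal \<Rightarrow> ereal \<Rightarrow> ereal" where
  "threshold \<alpha> b s = (if s \<le> \<alpha> then b else \<infinity>)"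

lemma threshold_eq: "threshold \<alpha> (W_bias I e) (spike e) = threshold_weight I \<alpha> e"
  by (auto simp: threshold_def threshold_weight_def spike_def)

text \<open>If the label at the terminal has finite length, then it dominates all paths in the full
lexicographic sense. If its length is infinite, all paths have infinite length, and the scan with
zero weights, whose lengths are all finite and equal, selects a path of least maximal spike. The
restriction to a horizon of at least two is needed to identify \<^const>\<open>walk_spike\<close> with
\<^const>\<open>max_spike\<close>.\<close>

lemma result_shortestT:
  assumes fs: "set fs = arcs G" "sorted (map (arc_time I) fs)"
  shows "case result (shortestT I \<alpha> (map annotate fs)) of
      None \<Rightarrow> PATH I = {}
    | Some (d, m, q) \<Rightarrow> (\<exists>p\<in>PATH I. q = rev (map annotate p) \<and>
        (2 \<le> horizon I \<longrightarrow> shortest_path I \<alpha> p))"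
proof -
  have len: "walk_length (threshold \<alpha>) p = sum_list (map (threshold_weight I \<alpha>) p)" for p
    by (simp add: walk_length_def threshold_eq)
  have fin: "threshold \<alpha> (W_bias I e) (spike e) \<noteq> -\<infinity>" if "e \<in> arcs G" for e
    using W_bias_not_MInfty [OF that] by (simp add: threshold_def)
  have zero: "walk_length (\<lambda>b s. 0) p = 0" for p
    by (simp add: walk_length_def)
  note scan1 = result_scanT [of fs "threshold \<alpha>", OF fs fin]
  note scan2 = result_scanT [OF fs, of "\<lambda>b s. 0"]
  have shortestT: "result (shortestT I \<alpha> (map annotate fs)) =
      (case result (scanT I (threshold \<alpha>) (map annotate fs)) of None \<Rightarrow> None
       | Some (d, m, p) \<Rightarrow> if d = \<infinity> then result (scanT I (\<lambda>b s. 0) (map annotate fs))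
          else Some (d, m, p))"
    by (simp add: shortestT_def threshold_def [abs_def] split: option.split)
  show ?thesis
  proof (cases "result (scanT I (threshold \<alpha>) (map annotate fs))")
    case None
    then show ?thesis using scan1 shortestT by simp
  next
    case (Some l)
    then obtain d m q where l: "result (scanT I (threshold \<alpha>) (map annotate fs)) = Some (d, m, q)"
      by (cases l) auto
    obtain p where p: "p \<in> PATH I" "d = sum_list (map (threshold_weight I \<alpha>) p)"
        "m = walk_spike p" "q = rev (map annotate p)"
      using scan1 l by (auto simp: represents_def len)
    have dom: "d \<le> sum_list (map (threshold_weight I \<alpha>) p')"
      "d = sum_list (map (threshold_weight I \<alpha>) p') \<Longrightarrow> d \<noteq> \<infinity> \<Longrightarrow> m \<le> walk_spike p'"
      if "p' \<in> PATH I" for p'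
      using scan1 l that by (auto simp: dominates_def len)
    show ?thesis
    proof (cases "d = \<infinity>")
      case False
      have "shortest_path I \<alpha> p" if T: "2 \<le> horizon I"
        unfolding shortest_path_def Let_def
        using p dom False walk_spike_eq_max_spike [OF T] by (auto simp: less_le)
      then show ?thesis
        using p False by (auto simp: shortestT l)
    next
      case True
      obtain l2 where l2: "result (scanT I (\<lambda>b s. 0) (map annotate fs)) = Some l2"
        using scan2 p(1) by (cases "result (scanT I (\<lambda>b s. 0) (map annotate fs))") auto
      then obtain p2 where p2: "p2 \<in> PATH I" "l2 = (0, walk_spike p2, rev (map annotate p2))"
        using scan2 by (auto simp: represents_def zero)
      have dom2: "walk_spike p2 \<le> walk_spike p'" if "p' \<in> PATH I" for p'
        using scan2 l2 that p2(2) by (auto simp: dominates_def zero)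
      have all: "sum_list (map (threshold_weight I \<alpha>) p') = \<infinity>" if "p' \<in> PATH I" for p'
        using dom(1) [OF that] True by simp
      have "shortest_path I \<alpha> p2" if T: "2 \<le> horizon I"
        unfolding shortest_path_def Let_def
        using p2(1) all dom2 walk_spike_eq_max_spike [OF T] by auto
      then show ?thesis
        using p2 l2 True by (auto simp: shortestT l)
    qed
  qed
qed

lemma result_valueT:
  assumes "2 \<le> horizon I" "p \<in> PATH I"
  shows "result (valueT (rev (map annotate p))) = V_cost I p"
proof -
  have "fold (\<lambda>a BS. (fst BS + fst (snd a), max (snd BS) (snd (snd a)))) (map annotate q) (B, S)
      = (B + sum_list (map (W_bias I) q), fold (\<lambda>e m. max m (spike e)) q S)" for q B S
    by (induction q arbitrary: B S) (simp_all add: annotate_def ac_simps)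
  from this [of "rev p" 0 "-\<infinity>"] show ?thesis
    using walk_spike_eq_max_spike [OF assms]
    by (simp add: valueT_def result_foldT fold_max V_cost_def walk_spike_def rev_map
        flip: sum_list_rev [of "map (W_bias I) p"])
qed

text \<open>The body of the loop over the thresholds in \<^const>\<open>algorithmT\<close>.\<close>

definition update_best :: "('x, 'u) warc list \<Rightarrow> (ereal \<times> ('x, 'u) warc list) option \<Rightarrow>
    ('x, 'u) warc \<Rightarrow> (ereal \<times> ('x, 'u) warc list) option timed" where
  "update_best as best a = (case a of (e, b, \<alpha>) \<Rightarrow>
     if is_Trans e then do {
       l \<leftarrow> shortestT I \<alpha> as;
       case l of
         None \<Rightarrow> step best
       | Some (d, m, p) \<Rightarrow> do {
           v \<leftarrow> valueT p;
           case best of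
             None \<Rightarrow> step (Some (v, p))
           | Some (v', p') \<Rightarrow> step (if v < v' then Some (v, p) else best) } }
     else step best)"

lemma algorithmT_eq:
  "algorithmT I es = do {
     ws \<leftarrow> annotateT I es;
     as \<leftarrow> sortT I ws;
     best \<leftarrow> foldT (update_best as) None as;
     case best of
       None \<Rightarrow> step None
     | Some (v, p) \<Rightarrow> do {
         q \<leftarrow> foldT (\<lambda>q a. step (fst a # q)) [] p;
         step (Some (v, q)) } }"
  unfolding algorithmT_def update_best_def [abs_def] ..

text \<open>The invariant of the loop after the arcs in \<open>S\<close>, where \<open>V_path \<alpha>\<close> is the path that the
computation returns for the threshold \<open>\<alpha>\<close>. The result of a scan depends on the arc only through
its threshold, so repeated spike values are harmless and \<open>V_path\<close> is a function of \<open>\<alpha>\<close>, as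
\<^const>\<open>algorithm_A\<close> requires.\<close>

definition best_correct :: "(ereal \<Rightarrow> ('x, 'u) arc list) \<Rightarrow> ('x, 'u) arc set \<Rightarrow>
    (ereal \<times> ('x, 'u) warc list) option \<Rightarrow> bool" where
  "best_correct V_path S best \<longleftrightarrow> (case best of
     None \<Rightarrow> \<forall>e\<in>S. \<not> is_Trans e
   | Some (v, q) \<Rightarrow> \<exists>\<gamma>\<in>W_spike I ` {e \<in> S. is_Trans e}.
       v = V_cost I (V_path \<gamma>) \<and> q = rev (map annotate (V_path \<gamma>)) \<and>
       (\<forall>\<beta>\<in>W_spike I ` {e \<in> S. is_Trans e}. v \<le> V_cost I (V_path \<beta>)))"

lemma fold_update_best_correct:
  assumes V_path: "\<And>\<alpha>. \<exists>d m. result (shortestT I \<alpha> as) = Some (d, m, rev (map annotate (V_path \<alpha>)))"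
    "\<And>\<alpha>. V_path \<alpha> \<in> PATH I"
    and "best_correct V_path S best" "set fs \<subseteq> arcs G"
  shows "best_correct V_path (S \<union> set fs)
    (fold (\<lambda>a best. result (update_best as best a)) (map annotate fs) best)"
  using assms(3,4)
proof (induction fs arbitrary: S best)
  case (Cons e fs)
  let ?best = "result (update_best as best (annotate e))"
  have "best_correct V_path (insert e S) ?best"
  proof (cases "is_Trans e")
    case False
    then have S: "{a \<in> insert e S. is_Trans a} = {a \<in> S. is_Trans a}" by auto
    have best: "?best = best"
      using False by (simp add: update_best_def annotate_def)
    show ?thesis
      using Cons.prems(1) False unfolding best_correct_def S best by (cases best) auto
  next
    case True
    define new where "new = V_cost I (V_path (W_spike I e))"
    have S: "{a \<in> insert e S. is_Trans a} = insert e {a \<in> S. is_Trans a}"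
      using True by auto
    have "2 \<le> horizon I" using Trans_imp_horizon [of e] True Cons.prems(2) by simp
    then have new_value: "result (valueT (rev (map annotate (V_path (W_spike I e))))) = new"
      using V_path(2) by (simp add: result_valueT new_def)
    obtain d m where "result (shortestT I (W_spike I e) as) =
        Some (d, m, rev (map annotate (V_path (W_spike I e))))"
      using V_path(1) by blast
    then have best: "?best = (case best of
        None \<Rightarrow> Some (new, rev (map annotate (V_path (W_spike I e))))
      | Some (v', p') \<Rightarrow> if new < v' then Some (new, rev (map annotate (V_path (W_spike I e)))) else best)"
      using True new_value by (simp add: update_best_def annotate_def spike_def split: option.split)
    show ?thesis
    proof (cases best)
      case None
      then have empty: "{a \<in> S. is_Trans a} = {}"
        using Cons.prems(1) by (auto simp: best_correct_def)
      show ?thesis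
        unfolding best best_correct_def S empty by (simp add: None new_def)
    next
      case (Some vq)
      obtain v q where vq: "vq = (v, q)" by (cases vq)
      obtain \<gamma> where \<gamma>: "\<gamma> \<in> W_spike I ` {e \<in> S. is_Trans e}" "v = V_cost I (V_path \<gamma>)"
          "q = rev (map annotate (V_path \<gamma>))"
          "\<And>\<beta>. \<beta> \<in> W_spike I ` {e \<in> S. is_Trans e} \<Longrightarrow> v \<le> V_cost I (V_path \<beta>)"
        using Cons.prems(1) unfolding best_correct_def Some vq option.case prod.case by blast
      show ?thesis
      proof (cases "new < v")
        case True
        then have "new \<le> V_cost I (V_path \<beta>)" if "\<beta> \<in> W_spike I ` insert e {e \<in> S. is_Trans e}" for \<beta>
          using \<gamma>(4) [of \<beta>] that by (auto simp: new_def)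
        then show ?thesis
          unfolding best best_correct_def S using True by (auto simp: Some vq new_def)
      next
        case False
        then have "v \<le> V_cost I (V_path \<beta>)" if "\<beta> \<in> W_spike I ` insert e {e \<in> S. is_Trans e}" for \<beta>
          using \<gamma>(4) [of \<beta>] that by (auto simp: new_def)
        then show ?thesis
          unfolding best best_correct_def S using False \<gamma>(1-3)
          by (simp add: Some vq) blast
      qed
    qed
  qed
  then show ?case
    using Cons.IH [of "insert e S" ?best] Cons.prems(2) by simp
qed simp

lemma sorted_arcs:
  assumes "set es = arcs G"
  obtains fs where "result (sortT I (result (annotateT I es))) = map annotate fs"
    "set fs = arcs G" "sorted (map (arc_time I) fs)" "length fs = length es"
proof -
  let ?as = "result (sortT I (result (annotateT I es)))" 
  have as: "set ?as = annotate ` arcs G" "length ?as = length es"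
    using assms by (simp_all add: result_sortT result_annotateT)
  have "a = annotate (fst a)" if "a \<in> set ?as" for a
    using that unfolding as(1) by (auto simp: annotate_def)
  then have eq: "map annotate (map fst ?as) = ?as"
    by (simp add: map_idI)
  have "fst ` annotate ` arcs G = arcs G"
    by (simp add: annotate_def image_image)
  then have "set (map fst ?as) = arcs G"
    by (simp only: set_map as(1))
  moreover have "sorted (map (arc_time I) (map fst ?as))"
    using result_sortT(3) by simp
  ultimately show ?thesis
    using that [of "map fst ?as"] eq as(2) by simp
qed

text \<open>The loop finds nothing in two cases: there is no path, so no shortest path either, or there is no
transition arc, so there is no threshold. In both, \<^const>\<open>algorithm_A\<close> has no output.\<close>

lemma algorithmT_correct:
  assumes es: "set es = arcs G"
  shows "case result (algorithmT I es) of
      None \<Rightarrow> \<not> (\<exists>v p. algorithm_A I v p)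
    | Some (v, p) \<Rightarrow> algorithm_A I v p"
proof -
  obtain fs where fs: "result (sortT I (result (annotateT I es))) = map annotate fs"
    "set fs = arcs G" "sorted (map (arc_time I) fs)"
    using sorted_arcs [OF es] .
  let ?as = "map annotate fs"
  define best where "best = fold (\<lambda>a best. result (update_best ?as best a)) ?as None"
  have rev: "fold (\<lambda>a q. fst a # q) q r = rev (map fst q) @ r" for q :: "('x, 'u) warc list" and r
    by (induction q arbitrary: r) simp_all
  have res: "result (algorithmT I es) = (case best of None \<Rightarrow> None | Some (v, q) \<Rightarrow> Some (v, rev (map fst q)))"
    by (simp add: algorithmT_eq fs(1) result_foldT best_def rev split: option.split)
  show ?thesis
  proof (cases "PATH I = {}")
    case True
    have "result (shortestT I \<alpha> ?as) = None" for \<alpha>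
      using result_shortestT [OF fs(2,3), of \<alpha>] True by (auto split: option.splits)
    then have "result (update_best ?as b a) = b" for b a
      by (simp add: update_best_def split: prod.split)
    then have "fold (\<lambda>a best. result (update_best ?as best a)) xs b = b" for xs b
      by (induction xs) simp_all
    then have "best = None" by (simp add: best_def)
    then show ?thesis
      using True algorithm_A_optimal(2) by (auto simp: res)
  next
    case False
    have "\<exists>p. (\<exists>d m. result (shortestT I \<alpha> ?as) = Some (d, m, rev (map annotate p))) \<and>
        p \<in> PATH I \<and> (2 \<le> horizon I \<longrightarrow> shortest_path I \<alpha> p)" for \<alpha>
      using result_shortestT [OF fs(2,3), of \<alpha>] False by (auto split: option.splits)
    then obtain V_path where V_path:
      "\<And>\<alpha>. \<exists>d m. result (shortestT I \<alpha> ?as) = Some (d, m, rev (map annotate (V_path \<alpha>)))"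
      "\<And>\<alpha>. V_path \<alpha> \<in> PATH I" "\<And>\<alpha>. 2 \<le> horizon I \<Longrightarrow> shortest_path I \<alpha> (V_path \<alpha>)"
      by metis
    have "best_correct V_path {} None" by (simp add: best_correct_def)
    then have "best_correct V_path ({} \<union> set fs) best"
      unfolding best_def using fs(2) by (intro fold_update_best_correct V_path) auto
    then have best: "best_correct V_path (arcs G) best" using fs(2) by simp
    show ?thesis
    proof (cases best)
      case None
      then have "Thresh I = {}" using best by (auto simp: best_correct_def Thresh_def)
      then show ?thesis using None by (simp add: res algorithm_A_def)
    next
      case (Some vq)
      obtain v q where vq: "vq = (v, q)" by (cases vq)
      obtain \<gamma> where \<gamma>: "\<gamma> \<in> Thresh I" "v = V_cost I (V_path \<gamma>)" "q = rev (map annotate (V_path \<gamma>))"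
          "\<And>\<beta>. \<beta> \<in> Thresh I \<Longrightarrow> v \<le> V_cost I (V_path \<beta>)"
        using best unfolding best_correct_def Some vq option.case prod.case Thresh_def by blast
      have "2 \<le> horizon I" using \<gamma>(1) Trans_imp_horizon by (auto simp: Thresh_def)
      moreover have "rev (map fst q) = V_path \<gamma>"
        by (simp add: \<gamma>(3) rev_map annotate_def comp_def)
      ultimately have "algorithm_A I v (rev (map fst q))"
        unfolding algorithm_A_def using V_path(3) \<gamma> by (intro exI [of _ V_path] exI [of _ \<gamma>]) auto
      then show ?thesis by (simp add: res Some vq)
    qed
  qed
qed

section \<open>Counting steps\<close>

lemma steps_weightT:
  assumes "card (arc_steps e) \<le> m"
  shows "steps (weightT I \<xi> e) \<le> 2 * m + 1"
proof (cases e)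
  case (Trans t x u)
  have "steps (foldT (\<lambda>s \<tau>. step (s + f \<tau>)) c xs) \<le> (1 + 1) * length xs + 1"
    for f :: "nat \<Rightarrow> ereal" and c xs
    by (intro steps_foldT_le) simp
  from this [of _ _ "[t..<t + duration I x u]"] show ?thesis
    unfolding weightT_def Trans arc.case by (rule order_trans) (use assms Trans in simp)
qed (simp_all add: weightT_def)

lemma steps_spikeT:
  assumes "card (arc_steps e) \<le> m"
  shows "steps (spikeT I b e) \<le> (4 * m + 4) * m + 2"
proof (cases e)
  case (Trans t x u)
  let ?g = "\<lambda>m k. do {
      wP \<leftarrow> weightT I (spike_P I k) e;
      wH \<leftarrow> weightT I (spike_H I k) e;
      step (max m (max wP wH)) }"
  have "steps (?g w k) \<le> 4 * m + 3" for w k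
    using steps_weightT [OF assms, of "spike_P I k"] steps_weightT [OF assms, of "spike_H I k"] by simp
  then have "steps (foldT ?g (-\<infinity>) [t..<t + duration I x u])
      \<le> (4 * m + 3 + 1) * length [t..<t + duration I x u] + 1"
    by (rule steps_foldT_le)
  also have "\<dots> \<le> (4 * m + 4) * m + 1"
    using assms Trans by (auto intro!: mult_le_mono)
  finally show ?thesis
    using Trans by (simp add: spikeT_def)
qed (simp_all add: spikeT_def)

lemma steps_annotateT:
  assumes "\<And>e. e \<in> set es \<Longrightarrow> card (arc_steps e) \<le> m"
  shows "steps (annotateT I es) \<le> ((2 * m + 1) + ((4 * m + 4) * m + 2) + 2) * length es + 1"
proof -
  let ?g = "\<lambda>as e. do {
      b \<leftarrow> weightT I (bias_demand I) e;
      s \<leftarrow> spikeT I b e;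
      step ((e, b, s) # as) }"
  have "steps (?g as e) \<le> (2 * m + 1) + ((4 * m + 4) * m + 2) + 1" if "e \<in> set es" for as e
    using steps_weightT [OF assms [OF that], of "bias_demand I"]
      steps_spikeT [OF assms [OF that], of "result (weightT I (bias_demand I) e)"]
    by simp
  then have "steps (foldT ?g [] es) \<le> ((2 * m + 1) + ((4 * m + 4) * m + 2) + 1 + 1) * length es + 1"
    by (rule steps_foldT_le)
  then show ?thesis by (simp add: annotateT_def)
qed

lemma steps_relaxT: "steps (relaxT I \<omega> lab a) = 1"
  by (simp add: relaxT_def Let_def split: prod.split option.split)

lemma steps_scanT: "steps (scanT I \<omega> as) \<le> 4 * length as + 4"
proof -
  have init: "steps (foldT (\<lambda>lab (e, b, s). step (lab(arc_tail I e := None, arc_head I e := None))) lab as)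
      \<le> (1 + 1) * length as + 1" for lab :: "('x, 'u) labelling"
    by (intro steps_foldT_le) (simp split: prod.split)
  have relax: "steps (foldT (relaxT I \<omega>) lab as) \<le> (1 + 1) * length as + 1" for lab
    by (intro steps_foldT_le) (simp add: steps_relaxT)
  have "i + (1 + (r + 1)) \<le> 4 * n + 4" if "i \<le> (1 + 1) * n + 1" "r \<le> (1 + 1) * n + 1" for i r n :: nat
    using that by simp
  from this [OF init relax] show ?thesis
    unfolding scanT_def steps_bind steps_step by blast
qed

lemma steps_shortestT: "steps (shortestT I \<alpha> as) \<le> 8 * length as + 8"
  unfolding shortestT_def
  using steps_scanT [of "\<lambda>b s. if s \<le> \<alpha> then b else \<infinity>" as] steps_scanT [of "\<lambda>b s. 0" as]
  by (simp split: option.split)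

text \<open>Evaluating a path and copying it into the result take time linear in its length. A path does not
repeat arcs, so its length is at most the number of arcs (\<open>length_PATH\<close>).\<close>

lemma steps_valueT: "steps (valueT p) \<le> 2 * length p + 2"
proof -
  have "steps (foldT (\<lambda>BS a. step (fst BS + fst (snd a), max (snd BS) (snd (snd a)))) (0, -\<infinity>) p)
      \<le> (1 + 1) * length p + 1"
    by (intro steps_foldT_le) simp
  then show ?thesis by (simp add: valueT_def)
qed

lemma length_PATH:
  assumes "p \<in> PATH I"
  shows "length p \<le> card (arcs G)"
proof -
  have "distinct p" "set p \<subseteq> arcs G"
    using assms awalk_distinct(1) PATH_arcs by (auto simp: PATH_eq)
  then show ?thesis
    using card_mono [OF finite_arcs] distinct_card by metis
qed

lemma result_shortestT_length:
  assumes "set fs = arcs G" "sorted (map (arc_time I) fs)"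
    and "result (shortestT I \<alpha> (map annotate fs)) = Some (d, m, q)"
  shows "length q \<le> card (arcs G)"
  using result_shortestT [OF assms(1,2), of \<alpha>] assms(3) length_PATH by auto

lemma steps_update_best:
  assumes fs: "set fs = arcs G" "sorted (map (arc_time I) fs)" "length fs = card (arcs G)"
  shows "steps (update_best (map annotate fs) best a) \<le> 10 * card (arcs G) + 11"
proof -
  obtain e b \<alpha> where a: "a = (e, b, \<alpha>)" by (cases a)
  let ?n = "card (arcs G)"
  have short: "steps (shortestT I \<alpha> (map annotate fs)) \<le> 8 * ?n + 8"
    using steps_shortestT [of \<alpha> "map annotate fs"] fs(3) by simp
  show ?thesis
  proof (cases "is_Trans e")
    case False
    then show ?thesis by (simp add: update_best_def a)
  next
    case True
    show ?thesis
    proof (cases "result (shortestT I \<alpha> (map annotate fs))")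
      case None
      then show ?thesis using short True by (simp add: update_best_def a)
    next
      case (Some l)
      then obtain d m q where l: "result (shortestT I \<alpha> (map annotate fs)) = Some (d, m, q)"
        by (cases l) auto
      have "steps (valueT q) \<le> 2 * ?n + 2"
        using steps_valueT [of q] result_shortestT_length [OF fs(1,2) l] by linarith
      then show ?thesis
        using short True by (simp add: update_best_def a l split: option.split)
    qed
  qed
qed

lemma length_best:
  assumes "set fs = arcs G" "sorted (map (arc_time I) fs)"
    and "\<And>v q. best = Some (v, q) \<Longrightarrow> length q \<le> card (arcs G)"
    and "fold (\<lambda>a best. result (update_best (map annotate fs) best a)) as best = Some (v, q)"
  shows "length q \<le> card (arcs G)"
  using assms(3,4)
proof (induction as arbitrary: best)
  case (Cons a as)
  let ?best = "result (update_best (map annotate fs) best a)"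
  have "length q \<le> card (arcs G)" if "?best = Some (v, q)" for v q
    using that Cons.prems(1) result_shortestT_length [OF assms(1,2)]
    by (auto simp: update_best_def split: prod.splits option.splits if_splits)
  then show ?case
    using Cons.IH [of ?best] Cons.prems(2) by simp
qed simp

text \<open>The loop dominates: for each of the \<open>n\<close> arcs there are at most two scans and one evaluation of a
path, all of them linear in \<open>n\<close>. The coefficient of the bound absorbs the lower order terms by
\<open>n \<le> n * n\<close>.\<close>

lemma steps_algorithmT:
  assumes es: "set es = arcs G" "distinct es" "es \<noteq> []"
    and m: "\<And>e. e \<in> arcs G \<Longrightarrow> card (arc_steps e) \<le> m"
  shows "steps (algorithmT I es) \<le> (4 * m * m + 6 * m + 38) * (card (arcs G))\<^sup>2"
proof -
  obtain fs where fs: "result (sortT I (result (annotateT I es))) = map annotate fs"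
    "set fs = arcs G" "sorted (map (arc_time I) fs)" "length fs = length es"
    using sorted_arcs [OF es(1)] .
  define n where "n = card (arcs G)"
  have n: "length es = n" "length fs = n"
    using distinct_card [OF es(2)] es(1) fs(4) by (simp_all add: n_def)
  have n1: "1 \<le> n" using n(1) es(3) by (cases es) auto
  define best where "best = fold (\<lambda>a best. result (update_best (map annotate fs) best a)) (map annotate fs) None"
  have annotate: "steps (annotateT I es) \<le> (4 * m * m + 6 * m + 5) * n + 1"
    using steps_annotateT [of es m] m es(1) n(1) by (simp add: algebra_simps)
  have sort: "steps (sortT I (result (annotateT I es))) \<le> n * (n + 2) + 1"
    using steps_sortT [of "result (annotateT I es)"] result_annotateT [of es] es(1) n(1) by simp
  have loop: "steps (foldT (update_best (map annotate fs)) None (map annotate fs)) \<le> (10 * n + 12) * n + 1"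
  proof -
    have "steps (foldT (update_best (map annotate fs)) None (map annotate fs))
        \<le> (10 * n + 11 + 1) * length (map annotate fs) + 1"
      unfolding n_def by (intro steps_foldT_le steps_update_best fs) (simp add: n n_def [symmetric])
    then show ?thesis by (simp add: n(2) algebra_simps)
  qed
  have final: "steps (case best of None \<Rightarrow> step None
      | Some (v, p) \<Rightarrow> do { q \<leftarrow> foldT (\<lambda>q a. step (fst a # q)) [] p; step (Some (v, q)) }) \<le> 2 * n + 2"
  proof (cases best)
    case (Some vq)
    obtain v q where vq: "vq = (v, q)" by (cases vq)
    have "length q \<le> n"
      using length_best [OF fs(2,3), of None "map annotate fs" v q] Some vq
      by (simp add: best_def n_def)
    moreover have "steps (foldT (\<lambda>q a. step (fst a # q)) [] q) \<le> (1 + 1) * length q + 1"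
      by (intro steps_foldT_le) simp
    ultimately show ?thesis by (simp add: Some vq)
  qed simp
  have "steps (algorithmT I es) \<le> ((4 * m * m + 6 * m + 5) * n + 1) + (n * (n + 2) + 1)
      + ((10 * n + 12) * n + 1) + (2 * n + 2)"
    using annotate sort loop final
    by (simp add: algorithmT_eq fs(1) result_foldT best_def)
  also have "\<dots> = 11 * (n * n) + (4 * m * m + 6 * m + 21) * n + 5"
    by (simp add: algebra_simps)
  also have "\<dots> \<le> 11 * (n * n) + (4 * m * m + 6 * m + 21) * (n * n) + 5 * (n * n)"
    using n1 by (intro add_mono mult_le_mono order_refl) auto
  also have "\<dots> \<le> (4 * m * m + 6 * m + 38) * n\<^sup>2"
    by (simp add: algebra_simps power2_eq_square)
  finally show ?thesis by (simp add: n_def)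
qed

end

section \<open>Optimality and running time of the algorithm\<close>

theorem theorem2:
  shows
    "(\<forall>I :: ('x, 'u) dispatch. valid_dispatch I \<and> downward_feasible I \<longrightarrow>
        (\<forall>p\<in>PATH I. \<exists>\<xi>\<in>demand_set I. path_cost I \<xi> p = robust_cost I p) \<and>
        (\<forall>v p. algorithm_A I v p \<longrightarrow> robust_solution I v p) \<and>
        (2 \<le> horizon I \<and> PATH I \<noteq> {} \<longrightarrow> (\<exists>v p. algorithm_A I v p))) \<and>
     (\<forall>m. \<exists>K. \<forall>(I :: ('x, 'u) dispatch) es.
        valid_dispatch I \<and> (\<forall>x\<in>states I. \<forall>u\<in>controls I x. duration I x u \<le> m) \<and>
        distinct es \<and> set es = arcs (dispatch_graph I) \<and> es \<noteq> [] \<longrightarrow>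
          (case result (algorithmT I es) of
             None \<Rightarrow> \<not> (\<exists>v p. algorithm_A I v p)
           | Some (v, p) \<Rightarrow> algorithm_A I v p) \<and>
          steps (algorithmT I es) \<le> K * card (arcs (dispatch_graph I)) ^ 2)"
proof (rule conjI; intro allI impI)
  fix I :: "('x, 'u) dispatch"
  assume I: "valid_dispatch I \<and> downward_feasible I"
  interpret valid_instance I using I by unfold_locales simp
  from I show "(\<forall>p\<in>PATH I. \<exists>\<xi>\<in>demand_set I. path_cost I \<xi> p = robust_cost I p) \<and>
      (\<forall>v p. algorithm_A I v p \<longrightarrow> robust_solution I v p) \<and>
      (2 \<le> horizon I \<and> PATH I \<noteq> {} \<longrightarrow> (\<exists>v p. algorithm_A I v p))"
    using worst_case_attained algorithm_A_robust algorithm_A_exists by blast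
next
  fix m :: nat
  show "\<exists>K. \<forall>(I :: ('x, 'u) dispatch) es.
      valid_dispatch I \<and> (\<forall>x\<in>states I. \<forall>u\<in>controls I x. duration I x u \<le> m) \<and>
      distinct es \<and> set es = arcs (dispatch_graph I) \<and> es \<noteq> [] \<longrightarrow>
        (case result (algorithmT I es) of
           None \<Rightarrow> \<not> (\<exists>v p. algorithm_A I v p)
         | Some (v, p) \<Rightarrow> algorithm_A I v p) \<and>
        steps (algorithmT I es) \<le> K * card (arcs (dispatch_graph I)) ^ 2"
  proof (intro exI [of _ "4 * m * m + 6 * m + 38"] allI impI)
    fix I :: "('x, 'u) dispatch" and es
    assume I: "valid_dispatch I \<and> (\<forall>x\<in>states I. \<forall>u\<in>controls I x. duration I x u \<le> m) \<and>
      distinct es \<and> set es = arcs (dispatch_graph I) \<and> es \<noteq> []"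
    interpret valid_instance I using I by unfold_locales simp
    have "card (arc_steps e) \<le> m" if "e \<in> arcs (dispatch_graph I)" for e
      using that I by (cases rule: arc_cases) auto
    then show "(case result (algorithmT I es) of
           None \<Rightarrow> \<not> (\<exists>v p. algorithm_A I v p)
         | Some (v, p) \<Rightarrow> algorithm_A I v p) \<and>
        steps (algorithmT I es) \<le> (4 * m * m + 6 * m + 38) * card (arcs (dispatch_graph I)) ^ 2"
      using algorithmT_correct steps_algorithmT I by blast
  qed
qed

end
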